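(* Let $\ell\ge2$, $R_0^*\in SO(3)$ with unit quaternion representation $w_0^*$, and let $(y_i,x_i)$, $i=1,\dots,\ell$, satisfy $y_i=R_0^*x_i+\epsilon_i$ with $\epsilon_i\in\mathbb{R}^3$ (all pairs are noisy inliers). Let $c_1^2,\dots,c_\ell^2\ge0$, let $\hat w_0\in\mathbb{S}^3$ be a global minimizer of (TLS-Q), and $\hat\omega=[\hat w_0;\dots;\hat w_0]\in\mathbb{R}^{4(\ell+1)}$. Let $$\zeta=\frac{\lambda_{\min 2}\big(\sum_{i=1}^\ell Q_i\big)}{\lambda_{\min}\big(\sum_{i=1}^\ell Q_i\big)}$$ and suppose $\zeta\ge\ell/(\ell-1)$. If for every $i=1,\dots,\ell$ $$c_i^2>\hat w_0^\top Q_i\hat w_0+\|Q_i\hat w_0\|_2+\frac{|d_i|+d_i}{2},\qquad d_i:=\frac{\sum_{k=1}^\ell\hat w_0^\top Q_k\hat w_0}{\ell}-\hat w_0^\top Q_i\hat w_0+\frac{\lambda_{\max}\big(\sum_{j\ne i}(Q_i-Q_j)\big)}{\zeta(\ell-1)},$$ then (SDR) is tight. Moreover, the angle $\hat\tau_0^*$ between $\hat w_0$ and $w_0^*$ satisfies $$\sin^2(\hat\tau_0^* ):=1-(\hat w_0^\top w_0^* )^2\le\frac{4\sum_{i=1}^\ell\|\epsilon_i\|_2\|x_i\|_2}{\lambda_{\min 2}\big(\sum_{i=1}^\ell P_i\big)}.$$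
   Context: For $w=[w_1;w_2;w_3;w_4]\in\mathbb{S}^3$, $R(w)=\begin{bmatrix} w_1^2+w_2^2-w_3^2-w_4^2 & 2(w_2w_3-w_1w_4) & 2(w_2w_4+w_1w_3)\\ 2(w_2w_3+w_1w_4) & w_1^2+w_3^2-w_2^2-w_4^2 & 2(w_3w_4-w_1w_2)\\ 2(w_2w_4-w_1w_3) & 2(w_3w_4+w_1w_2) & w_1^2+w_4^2-w_2^2-w_3^2\end{bmatrix}\in SO(3)$; $\pm w$ are the unit quaternion representations of $R(w)$. $Q_i$ is the unique symmetric $4\times4$ matrix with $w^\top Q_iw=\|y_i-R(w)x_i\|_2^2$ for all $w\in\mathbb{S}^3$, and $P_i$ the unique symmetric $4\times4$ matrix with $w^\top P_iw=\|R_0^*x_i-R(w)x_i\|_2^2$ for all $w\in\mathbb{S}^3$ (the "pure data" part of $Q_i$; $P_i\succeq0$, $P_iw_0^*=0$). $\lambda_{\min},\lambda_{\min2},\lambda_{\max}$ denote the smallest, second smallest (counting multiplicity) and largest eigenvalues. (TLS-Q) is $\min_{w_0\in\mathbb{S}^3}\sum_{i=1}^\ell\min\{w_0^\top Q_iw_0,c_i^2\}$. For $\mathcal{A}\in\mathbb{R}^{4(\ell+1)\times4(\ell+1)}$, $[\mathcal{A}]_{ij}$ ($0\le i,j\le\ell$) is the $4\times4$ block in rows $4i+1..4i+4$, columns $4j+1..4j+4$. $\mathcal{Q}$ is symmetric with $[\mathcal{Q}]_{0i}=[\mathcal{Q}]_{i0}=\frac12(Q_i-c_i^2I_4)$ ($i\ge1$),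 other blocks zero. (QCQP): minimize $\operatorname{tr}(\mathcal{Q}\omega\omega^\top)+\sum_ic_i^2$ over $\omega\in\mathbb{R}^{4(\ell+1)}$ s.t. $[\omega\omega^\top]_{0i}=[\omega\omega^\top]_{ii}$ ($i=1..\ell$), $\operatorname{tr}([\omega\omega^\top]_{00})=1$. (SDR): minimize $\operatorname{tr}(\mathcal{Q}\mathcal{W})+\sum_ic_i^2$ over symmetric $\mathcal{W}\succeq0$ with the same constraints on $\mathcal{W}$. (SDR) is tight if it admits $\hat\omega\hat\omega^\top$ as a global minimizer, where $\hat\omega$ is a global minimizer of (QCQP) (here $\hat\omega=[\hat w_0;\dots;\hat w_0]$). *)

theory Defs
  imports "Jordan_Normal_Form.Char_Poly" "HOL-Computational_Algebra.Polynomial"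
begin

definition vnorm :: "real vec \<Rightarrow> real" where
  "vnorm v = sqrt (v \<bullet> v)"

definition sphere3 :: "real vec set" where
  "sphere3 = {w. dim_vec w = 4 \<and> vnorm w = 1}"

definition mtrace :: "real mat \<Rightarrow> real" where
  "mtrace A = (\<Sum>i<dim_row A. A $$ (i,i))"

definition msum4 :: "nat set \<Rightarrow> (nat \<Rightarrow> real mat) \<Rightarrow> real mat" where
  "msum4 I f = mat 4 4 (\<lambda>(r,s). \<Sum>i\<in>I. f i $$ (r,s))"

definition eigs :: "real mat \<Rightarrow> real list" where
  "eigs A = sorted_list_of_multiset (proots (char_poly A))"

definition lambda_min :: "real mat \<Rightarrow> real" where
  "lambda_min A = eigs A ! 0"

definition lambda_min2 :: "real mat \<Rightarrow> real" where
  "lambda_min2 A = eigs A ! 1"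

definition lambda_max :: "real mat \<Rightarrow> real" where
  "lambda_max A = last (eigs A)"

definition psd :: "real mat \<Rightarrow> bool" where
  "psd A \<longleftrightarrow> A \<in> carrier_mat (dim_row A) (dim_row A) \<and> A\<^sup>T = A \<and>
     (\<forall>v. dim_vec v = dim_row A \<longrightarrow> v \<bullet> (A *\<^sub>v v) \<ge> 0)"

definition rotq :: "real vec \<Rightarrow> real mat" where
  "rotq w = (let w1 = w $ 0; w2 = w $ 1; w3 = w $ 2; w4 = w $ 3 in
     mat_of_rows_list 3
      [[w1^2 + w2^2 - w3^2 - w4^2, 2*(w2*w3 - w1*w4), 2*(w2*w4 + w1*w3)],
       [2*(w2*w3 + w1*w4), w1^2 + w3^2 - w2^2 - w4^2, 2*(w3*w4 - w1*w2)],
       [2*(w2*w4 - w1*w3), 2*(w3*w4 + w1*w2), w1^2 + w4^2 - w2^2 - w3^2]])"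

definition quad_rep :: "(real vec \<Rightarrow> real) \<Rightarrow> real mat" where
  "quad_rep f = (THE M. M \<in> carrier_mat 4 4 \<and> M\<^sup>T = M \<and>
      (\<forall>w\<in>sphere3. w \<bullet> (M *\<^sub>v w) = f w))"

definition Qmat :: "real vec \<Rightarrow> real vec \<Rightarrow> real mat" where
  "Qmat y x = quad_rep (\<lambda>w. (vnorm (y - rotq w *\<^sub>v x))^2)"

definition Pmat :: "real mat \<Rightarrow> real vec \<Rightarrow> real mat" where
  "Pmat R0 x = quad_rep (\<lambda>w. (vnorm (R0 *\<^sub>v x - rotq w *\<^sub>v x))^2)"

text \<open>Objective of (TLS-Q); Q i and c2 i = c_i^2 for i = 1..l.\<close>
definition tlsq_obj :: "nat \<Rightarrow> (nat \<Rightarrow> real mat) \<Rightarrow> (nat \<Rightarrow> real) \<Rightarrow> real vec \<Rightarrow> real" where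
  "tlsq_obj l Q c2 w = (\<Sum>i=1..l. min (w \<bullet> (Q i *\<^sub>v w)) (c2 i))"

definition blk :: "real mat \<Rightarrow> nat \<Rightarrow> nat \<Rightarrow> real mat" where
  "blk A i j = mat 4 4 (\<lambda>(r,s). A $$ (4*i + r, 4*j + s))"

text \<open>The big data matrix \<Q> of size 4(l+1): [\<Q>]_{0i} = [\<Q>]_{i0} = (Q_i - c_i^2 I)/2, others 0.\<close>
definition bigQ :: "nat \<Rightarrow> (nat \<Rightarrow> real mat) \<Rightarrow> (nat \<Rightarrow> real) \<Rightarrow> real mat" where
  "bigQ l Q c2 = mat (4*(l+1)) (4*(l+1)) (\<lambda>(r,s).
     (if r div 4 = 0 \<and> 1 \<le> s div 4 then
        ((1/2) \<cdot>\<^sub>m (Q (s div 4) - c2 (s div 4) \<cdot>\<^sub>m 1\<^sub>m 4)) $$ (r mod 4, s mod 4)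
      else if s div 4 = 0 \<and> 1 \<le> r div 4 then
        ((1/2) \<cdot>\<^sub>m (Q (r div 4) - c2 (r div 4) \<cdot>\<^sub>m 1\<^sub>m 4)) $$ (r mod 4, s mod 4)
      else 0))"

definition relax_obj :: "nat \<Rightarrow> (nat \<Rightarrow> real mat) \<Rightarrow> (nat \<Rightarrow> real) \<Rightarrow> real mat \<Rightarrow> real" where
  "relax_obj l Q c2 W = mtrace (bigQ l Q c2 * W) + (\<Sum>i=1..l. c2 i)"

definition relax_constr :: "nat \<Rightarrow> real mat \<Rightarrow> bool" where
  "relax_constr l W \<longleftrightarrow> (\<forall>i\<in>{1..l}. blk W 0 i = blk W i i) \<and> mtrace (blk W 0 0) = 1"

definition outer :: "real vec \<Rightarrow> real mat" where
  "outer v = mat (dim_vec v) (dim_vec v) (\<lambda>(r,s). v $ r * v $ s)"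

definition qcqp_feasible :: "nat \<Rightarrow> real vec \<Rightarrow> bool" where
  "qcqp_feasible l v \<longleftrightarrow> dim_vec v = 4*(l+1) \<and> relax_constr l (outer v)"

definition sdr_feasible :: "nat \<Rightarrow> real mat \<Rightarrow> bool" where
  "sdr_feasible l W \<longleftrightarrow> W \<in> carrier_mat (4*(l+1)) (4*(l+1)) \<and> psd W \<and> relax_constr l W"

definition qcqp_global_min :: "nat \<Rightarrow> (nat \<Rightarrow> real mat) \<Rightarrow> (nat \<Rightarrow> real) \<Rightarrow> real vec \<Rightarrow> bool" where
  "qcqp_global_min l Q c2 v \<longleftrightarrow> qcqp_feasible l v \<and>
     (\<forall>u. qcqp_feasible l u \<longrightarrow> relax_obj l Q c2 (outer v) \<le> relax_obj l Q c2 (outer u))"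

definition sdr_global_min :: "nat \<Rightarrow> (nat \<Rightarrow> real mat) \<Rightarrow> (nat \<Rightarrow> real) \<Rightarrow> real mat \<Rightarrow> bool" where
  "sdr_global_min l Q c2 W \<longleftrightarrow> sdr_feasible l W \<and>
     (\<forall>V. sdr_feasible l V \<longrightarrow> relax_obj l Q c2 W \<le> relax_obj l Q c2 V)"

definition sdr_tight_at :: "nat \<Rightarrow> (nat \<Rightarrow> real mat) \<Rightarrow> (nat \<Rightarrow> real) \<Rightarrow> real vec \<Rightarrow> bool" where
  "sdr_tight_at l Q c2 v \<longleftrightarrow> qcqp_global_min l Q c2 v \<and> sdr_global_min l Q c2 (outer v)"

definition stack :: "nat \<Rightarrow> real vec \<Rightarrow> real vec" where
  "stack l w = vec (4*(l+1)) (\<lambda>r. w $ (r mod 4))"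

end

theory Submission
  imports Defs "Jordan_Normal_Form.Schur_Decomposition"
begin

text \<open>
  On the sphere, \<open>w \<bullet> Q w = |y w - w x|\<^sup>2\<close> as quaternions. By the bounds on \<open>c2\<close> the TLS minimiser \<open>h\<close>
  minimises the form of \<open>S = \<Sum>\<^sub>i Q\<^sub>i\<close> on the sphere, so \<open>h\<close> is an eigenvector for the least
  eigenvalue \<open>\<mu>\<close>, and \<open>S \<ge> \<zeta> \<mu>\<close> on the complement of \<open>h\<close>.

  For feasible \<open>W\<close> put \<open>X\<^sub>0 = [W]\<^sub>0\<^sub>0\<close> and \<open>X\<^sub>i = [W]\<^sub>0\<^sub>i = [W]\<^sub>i\<^sub>i\<close>. Then \<open>0 \<le> X\<^sub>i \<le> X\<^sub>0\<close>, and
  for any symmetric \<open>G\<^sub>i\<close> the objective equals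
  \<open>\<Sum>\<^sub>i (tr (G\<^sub>i X\<^sub>i) + tr ((c\<^sub>i\<^sup>2 - Q\<^sub>i + G\<^sub>i) (X\<^sub>0 - X\<^sub>i))) + tr ((\<Sum>\<^sub>i (Q\<^sub>i - G\<^sub>i)) X\<^sub>0)\<close>.
  It is at least \<open>\<mu>\<close> as soon as \<open>G\<^sub>i \<ge> 0\<close>, \<open>Q\<^sub>i - G\<^sub>i \<le> c\<^sub>i\<^sup>2\<close> and \<open>\<Sum>\<^sub>i (Q\<^sub>i - G\<^sub>i) \<ge> \<mu>\<close>. With
  \<open>t = l / (\<zeta> (l - 1)) \<le> 1\<close>, the compression of \<open>(1 - t) Q\<^sub>i + (t / l) S - \<mu> / l\<close> to the
  complement of \<open>h\<close> is such a \<open>G\<^sub>i\<close>: the third condition holds with equality, and the second is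
  where the \<open>d\<^sub>i\<close> of the statement come from.

  The angle bound compares \<open>h\<close> with \<open>w\<^sub>0\<close> in the minimality of \<open>h\<close>. Its denominator is positive: two
  independent quaternions annihilated by all \<open>P\<^sub>i\<close> differ by a right factor \<open>g\<close> commuting with every
  \<open>x\<^sub>i\<close>, so \<open>w \<mapsto> w g\<close> preserves the form of \<open>S\<close>, which forces \<open>\<zeta> = 1\<close>.
\<close>

subsection \<open>Spectral theorem for real symmetric matrices\<close>

text \<open>The library facts on \<open>v \<bullet> conjugate v\<close> thereby become facts on
  squared lengths of real vectors.\<close>

lemma conjugate_real_vec [simp]: "conjugate (v :: real vec) = v"
  by (rule eq_vecI) auto

lemma symmetric_form_commute:
  fixes A :: "'a :: comm_semiring_0 mat"
  assumes "A \<in> carrier_mat n n" "A\<^sup>T = A" "u \<in> carrier_vec n" "v \<in> carrier_vec n"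
  shows "u \<bullet> (A *\<^sub>v v) = v \<bullet> (A *\<^sub>v u)"
proof -
  have "u \<bullet> (A *\<^sub>v v) = (A\<^sup>T *\<^sub>v u) \<bullet> v"
    using transpose_vec_mult_scalar[OF assms(1,4,3)] by simp
  then show ?thesis
    using assms by (metis comm_scalar_prod mult_mat_vec_carrier)
qed

text \<open>An eigenvector \<open>v\<close> of the complexified matrix, paired with
  \<open>conjugate v\<close> in both orders, gives \<open>a = cnj a\<close>, because the bilinear
  form is symmetric and \<open>conjugate v \<bullet> v\<close> is nonzero.\<close>

lemma symmetric_real_root:
  fixes A :: "real mat"
  assumes A: "A \<in> carrier_mat n n" and sym: "A\<^sup>T = A"
    and root: "poly (char_poly (map_mat complex_of_real A)) a = 0"
  shows "Im a = 0"
proof -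
  let ?B = "map_mat complex_of_real A"
  have B: "?B \<in> carrier_mat n n" and symB: "?B\<^sup>T = ?B"
    using A sym by (auto simp: map_mat_transpose)
  obtain v where v: "v \<in> carrier_vec n" "v \<noteq> 0\<^sub>v n" and ev: "?B *\<^sub>v v = a \<cdot>\<^sub>v v"
    using root B unfolding eigenvalue_root_char_poly[OF B, symmetric] eigenvalue_def eigenvector_def
    by auto
  have cv: "conjugate v \<in> carrier_vec n" using v by simp
  \<comment> \<open>All entries of \<open>?B\<close> are real, so conjugating the eigenvector
    equation leaves the matrix alone.\<close>
  have cev: "?B *\<^sub>v conjugate v = cnj a \<cdot>\<^sub>v conjugate v"
  proof -
    have "?B *\<^sub>v conjugate v = conjugate (?B *\<^sub>v v)"
      using v A by (intro eq_vecI) (auto simp: scalar_prod_def)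
    also have "\<dots> = cnj a \<cdot>\<^sub>v conjugate v"
      unfolding ev using v by (intro eq_vecI) auto
    finally show ?thesis .
  qed
  have "a * (conjugate v \<bullet> v) = conjugate v \<bullet> (?B *\<^sub>v v)"
    using v cv by (simp add: ev)
  also have "\<dots> = v \<bullet> (?B *\<^sub>v conjugate v)"
    using symmetric_form_commute[OF B symB cv v(1)] .
  also have "\<dots> = cnj a * (conjugate v \<bullet> v)"
    using v cv by (simp add: cev comm_scalar_prod[OF cv v(1)])
  finally have "a * (conjugate v \<bullet> v) = cnj a * (conjugate v \<bullet> v)" .
  moreover have "conjugate v \<bullet> v \<noteq> 0"
    using v by (metis comm_scalar_prod cv conjugate_square_eq_0_vec)
  ultimately have "a = cnj a" by simp
  then show ?thesis by (simp add: complex_eq_iff)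
qed

text \<open>The polynomial factors over the complex numbers with real roots only. The factorisation
  is then the image of a real one, and \<open>map_poly complex_of_real\<close> is injective.\<close>

lemma char_poly_symmetric_splits:
  fixes A :: "real mat"
  assumes A: "A \<in> carrier_mat n n" and sym: "A\<^sup>T = A"
  obtains es where "char_poly A = (\<Prod>e\<leftarrow>es. [:- e, 1:])"
proof -
  interpret mp: map_poly_inj_idom_hom complex_of_real ..
  let ?B = "map_mat complex_of_real A"
  have B: "?B \<in> carrier_mat n n" using A by simp
  obtain as where as: "char_poly ?B = (\<Prod>a\<leftarrow>as. [:- a, 1:])"
    using char_poly_factorized[OF B] by blast
  have real: "complex_of_real (Re a) = a" if "a \<in> set as" for a
  proof -
    have "poly (char_poly ?B) a = 0"
      unfolding as using that by (auto simp: poly_prod_list prod_list_zero_iff)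
    then show ?thesis using symmetric_real_root[OF A sym] by (simp add: complex_eq_iff)
  qed
  have "map_poly complex_of_real (char_poly A) = (\<Prod>a\<leftarrow>as. [:- a, 1:])"
    using trans[OF of_real_hom.char_poly_hom[OF A, symmetric] as] .
  also have "\<dots> = map_poly complex_of_real (\<Prod>e\<leftarrow>map Re as. [:- e, 1:])"
    using real
  proof (induction as)
    case (Cons a as)
    have "map_poly complex_of_real [:- Re a, 1:] = [:- a, 1:]" using Cons.prems[of a] by simp
    then show ?case using Cons by (simp add: mp.hom_mult del: mult_pCons_left)
  qed simp
  finally have "char_poly A = (\<Prod>e\<leftarrow>map Re as. [:- e, 1:])"
    by simp
  then show ?thesis by (rule that)
qed

text \<open>\<open>v\<close> is extended to a basis and orthogonalised. Gram-Schmidt keeps the first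
  vector, and normalising the columns fixes it since it is already a unit vector.\<close>

lemma orthogonal_matrix_first_col:
  fixes v :: "real vec"
  assumes v: "v \<in> carrier_vec n" and nv: "v \<bullet> v = 1"
  obtains W where "W \<in> carrier_mat n n" "W\<^sup>T * W = 1\<^sub>m n" "col W 0 = v"
proof -
  interpret cof_vec_space n "TYPE(real)" .
  have v0: "v \<noteq> 0\<^sub>v n" using nv v by auto
  define b where "b = basis_completion v"
  from basis_completion[OF v v0, folded b_def]
  have dist_b: "distinct b" and indep: "\<not> lin_dep (set b)" and b: "set b \<subseteq> carrier_vec n"
    and hdb: "hd b = v" and len_b: "length b = n" by auto
  have n: "n > 0" using v0 v by (metis gr0I carrier_vecD eq_vecI index_zero_vec(2) not_less_zero)
  obtain vs where bv: "b = v # vs" using hdb len_b n by (cases b) auto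
  define ws where "ws = gram_schmidt n b"
  from gram_schmidt_result[OF b dist_b indep refl, folded ws_def]
  have ws: "set ws \<subseteq> carrier_vec n" "corthogonal ws" "length ws = n" by (auto simp: len_b)
  from gram_schmidt_hd[OF v, of vs, folded bv] have hdws: "ws ! 0 = v"
    unfolding ws_def using n ws by (metis hd_conv_nth list.size(3) ws_def less_not_refl)
  define W where "W = mat_of_cols n (map (\<lambda>w. (1 / sqrt (w \<bullet> w)) \<cdot>\<^sub>v w) ws)"
  have W: "W \<in> carrier_mat n n" unfolding W_def using ws by auto
  have colW: "col W i = (1 / sqrt (ws!i \<bullet> ws!i)) \<cdot>\<^sub>v ws!i" if "i < n" for i
    unfolding W_def using that ws by (subst col_mat_of_cols) auto
  have wsc: "ws!i \<in> carrier_vec n" if "i < n" for i using that ws by auto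
  have "W\<^sup>T * W = 1\<^sub>m n"
  proof (rule eq_matI)
    fix i j assume "i < dim_row (1\<^sub>m n)" "j < dim_col (1\<^sub>m n)"
    then have ij: "i < n" "j < n" by auto
    have "(W\<^sup>T * W) $$ (i,j) = col W i \<bullet> col W j" using W ij by simp
    also have "\<dots> = (1 / sqrt (ws!i \<bullet> ws!i)) * (1 / sqrt (ws!j \<bullet> ws!j)) * (ws!i \<bullet> ws!j)"
      using ij wsc[OF ij(1)] wsc[OF ij(2)] by (simp add: colW)
    also have "\<dots> = (1\<^sub>m n) $$ (i,j)"
    proof (cases "i = j")
      case True
      have "ws!i \<bullet> ws!i \<noteq> 0" using corthogonalD[OF ws(2), of i i] ij ws by simp
      moreover have "ws!i \<bullet> ws!i \<ge> 0" by (simp add: scalar_prod_def sum_nonneg)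
      ultimately show ?thesis using True ij by (simp add: divide_simps)
    next
      case False
      have "ws!i \<bullet> ws!j = 0" using corthogonalD[OF ws(2), of i j] ij ws False by simp
      then show ?thesis using False ij by simp
    qed
    finally show "(W\<^sup>T * W) $$ (i,j) = (1\<^sub>m n) $$ (i,j)" .
  qed (use W in auto)
  moreover have "col W 0 = v" using colW[OF n] hdws nv by simp
  ultimately show ?thesis using W that by blast
qed

text \<open>Deflation, by induction on the list of roots: a unit eigenvector for the first root
  becomes the first column of an orthogonal \<open>W\<close>, and \<open>B\<close> splits off a 1x1
  block. The list may come in any order, so the sorted one can be used later.\<close>

lemma orthogonal_diagonalization:
  fixes A :: "real mat"
  assumes "A \<in> carrier_mat n n" "A\<^sup>T = A" "char_poly A = (\<Prod>e\<leftarrow>es. [:- e, 1:])"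
  shows "length es = n \<and> (\<exists>U \<in> carrier_mat n n. U\<^sup>T * U = 1\<^sub>m n \<and>
    A * U = U * mat n n (\<lambda>(i,j). if i = j then es ! i else 0))"
  using assms
proof (induction es arbitrary: n A)
  case Nil
  with degree_monic_char_poly[of A n] have "n = 0" by auto
  with Nil show ?case by (intro conjI bexI[of _ "1\<^sub>m n"]) (auto intro!: eq_matI)
next
  case (Cons e es)
  let ?n1 = "n - 1"
  note A = Cons.prems(1) and sym = Cons.prems(2)
  have cp: "char_poly A = [: -e, 1 :] * (\<Prod>e \<leftarrow> es. [:- e, 1:])" using Cons.prems(3) by simp
  have mon: "monic (\<Prod>e\<leftarrow> es. [:- e, 1:])" by (rule monic_prod_list) auto
  have deg: "degree (char_poly A) = Suc (degree (\<Prod>e\<leftarrow> es. [:- e, 1:]))" unfolding cp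
    by (subst degree_mult_eq, insert mon, auto)
  with degree_monic_char_poly[OF A] have n: "n \<noteq> 0" by auto
  have "eigenvalue A e" unfolding eigenvalue_root_char_poly[OF A] cp by simp
  then obtain v' where v': "v' \<in> carrier_vec n" "v' \<noteq> 0\<^sub>v n" and ev': "A *\<^sub>v v' = e \<cdot>\<^sub>v v'"
    using A unfolding eigenvalue_def eigenvector_def by auto
  have pos: "v' \<bullet> v' > 0" using conjugate_square_greater_0_vec[OF v'(1)] v' by simp
  define v where "v = (1 / sqrt (v' \<bullet> v')) \<cdot>\<^sub>v v'"
  have v: "v \<in> carrier_vec n" unfolding v_def using v' by simp
  have nv: "v \<bullet> v = 1" unfolding v_def using v' pos by (simp add: divide_simps)
  have ev: "A *\<^sub>v v = e \<cdot>\<^sub>v v"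
    unfolding v_def using A v' by (simp add: mult_mat_vec ev' smult_smult_assoc mult.commute)
  obtain W where W: "W \<in> carrier_mat n n" and WW: "W\<^sup>T * W = 1\<^sub>m n" and col0: "col W 0 = v"
    by (rule orthogonal_matrix_first_col[OF v nv])
  have WT: "W\<^sup>T \<in> carrier_mat n n" using W by simp
  have WW': "W * W\<^sup>T = 1\<^sub>m n" using mat_mult_left_right_inverse[OF WT W WW] .
  define B where "B = W\<^sup>T * (A * W)"
  have B: "B \<in> carrier_mat n n" unfolding B_def using W A by simp
  have WB: "W * B = A * W"
    unfolding B_def using W WT A WW'
    by (simp add: assoc_mult_mat[of W n n "W\<^sup>T" n "A * W" n, symmetric])
  have symB: "B\<^sup>T = B"
    unfolding B_def using W WT A
    by (simp add: transpose_mult[of _ n n _ n] sym assoc_mult_mat[of _ n n _ n _ n])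
  have B0: "B $$ (i,0) = (if i = 0 then e else 0)" if "i < n" for i
  proof -
    have "B $$ (i,0) = col W i \<bullet> (A *\<^sub>v col W 0)"
      unfolding B_def using W A n that col_mult2[OF A W, of 0]
      by (subst index_mult_mat(1)) auto
    also have "\<dots> = e * (W\<^sup>T * W) $$ (i,0)"
      using W v that n by (simp add: col0 ev)
    finally show ?thesis using that n by (simp add: WW)
  qed
  \<comment> \<open>Symmetry carries the vanishing of the first column over to the first row, so
    \<open>B\<close> is block diagonal and not merely triangular.\<close>
  have B0': "B $$ (0,i) = (if i = 0 then e else 0)" if "i < n" for i
    using B0[OF that] B n that symB by (metis carrier_matD index_transpose_mat(1) gr0I)
  define A3 where "A3 = mat ?n1 ?n1 (\<lambda>(i,j). B $$ (Suc i, Suc j))"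
  let ?E = "mat 1 1 (\<lambda>_. e)"
  let ?Z = "0\<^sub>m 1 ?n1" and ?Z' = "0\<^sub>m ?n1 1 :: real mat"
  have A3: "A3 \<in> carrier_mat ?n1 ?n1" unfolding A3_def by simp
  have Bblock: "B = four_block_mat ?E ?Z ?Z' A3"
    using B n B0 B0' unfolding A3_def
    by (intro eq_matI) (auto simp: less_Suc_eq_0_disj)
  have symA3: "A3\<^sup>T = A3"
  proof (rule eq_matI)
    fix i j assume "i < dim_row A3" "j < dim_col A3"
    then have ij: "Suc i < n" "Suc j < n" using A3 by auto
    then have "B $$ (Suc j, Suc i) = B $$ (Suc i, Suc j)"
      using symB B by (metis carrier_matD index_transpose_mat(1))
    then show "A3\<^sup>T $$ (i,j) = A3 $$ (i,j)" using ij unfolding A3_def by simp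
  qed (use A3 in auto)
  \<comment> \<open>Similarity preserves the characteristic polynomial; cancelling the factor of the
    1x1 block leaves that of \<open>A3\<close>, as the induction hypothesis demands.\<close>
  have "similar_mat_wit B A (W\<^sup>T) W"
    by (rule similar_mat_witI[of _ _ n]) (use W WT A B WW WW' in \<open>auto simp: B_def assoc_mult_mat[of _ n n _ n _ n]\<close>)
  then have "char_poly B = char_poly A" by (intro char_poly_similar) (auto simp: similar_mat_def)
  then have "[: -e,1 :] * (\<Prod> e \<leftarrow> es. [:- e, 1:]) = char_poly ?E * char_poly A3"
    unfolding cp Bblock using char_poly_four_block_zeros_col[OF _ _ A3, of ?E ?Z] by (simp del: mult_pCons_left)
  moreover have "char_poly ?E = [: -e,1 :]"
    by (simp add: char_poly_defs det_def sign_def)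
  ultimately have cp3: "char_poly A3 = (\<Prod> e \<leftarrow> es. [:- e, 1:])"
    by (metis mult_cancel_left pCons_eq_0_iff zero_neq_one)
  let ?D3 = "mat ?n1 ?n1 (\<lambda>(i,j). if i = j then es ! i else 0)"
  let ?D = "mat n n (\<lambda>(i,j). if i = j then (e # es) ! i else 0)"
  from Cons.IH[OF A3 symA3 cp3] obtain U3 where len: "length es = ?n1"
    and U3: "U3 \<in> carrier_mat ?n1 ?n1" and UU3: "U3\<^sup>T * U3 = 1\<^sub>m ?n1" and AU3: "A3 * U3 = U3 * ?D3"
    by blast
  let ?I = "1\<^sub>m 1 :: real mat"
  define U' where "U' = four_block_mat ?I ?Z ?Z' U3"
  have n1: "Suc ?n1 = n" using n by simp
  have U': "U' \<in> carrier_mat n n"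
    unfolding U'_def using four_block_carrier_mat[OF _ U3, of ?I 1 1 ?Z ?Z'] n1 by simp
  have Dblock: "?D = four_block_mat ?E ?Z ?Z' ?D3"
    using n by (intro eq_matI) (auto simp: less_Suc_eq_0_disj nth_Cons')
  have D: "?D \<in> carrier_mat n n" by simp
  have "U'\<^sup>T = four_block_mat ?I ?Z ?Z' (U3\<^sup>T)"
    unfolding U'_def using U3 by (subst transpose_four_block_mat[of _ 1 1 _ ?n1 _ ?n1]) auto
  then have UU': "U'\<^sup>T * U' = 1\<^sub>m n"
    using U3 n UU3 unfolding U'_def
    by (simp, subst mult_four_block_mat[of _ 1 1 _ ?n1 _ ?n1 _ _ 1 _ ?n1]) (auto intro!: eq_matI)
  have BU: "B * U' = U' * ?D"
    unfolding U'_def Bblock Dblock using A3 U3 AU3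
    by (subst (1 2) mult_four_block_mat[of _ 1 1 _ ?n1 _ ?n1 _ _ 1 _ ?n1]) auto
  have "(W * U')\<^sup>T * (W * U') = U'\<^sup>T * ((W\<^sup>T * W) * U')"
    using W WT U' by (simp add: transpose_mult[of _ n n _ n] assoc_mult_mat[of _ n n _ n _ n])
  also have "\<dots> = 1\<^sub>m n" using U' UU' WW by simp
  finally have 1: "(W * U')\<^sup>T * (W * U') = 1\<^sub>m n" .
  have "A * (W * U') = W * (B * U')"
    using A W U' B WB assoc_mult_mat[of A n n W n U' n] assoc_mult_mat[of W n n B n U' n] by simp
  also have "\<dots> = (W * U') * ?D" using W U' D BU by (simp add: assoc_mult_mat[of W n n U' n ?D n])
  finally have 2: "A * (W * U') = (W * U') * ?D" .
  show ?case using 1 2 W U' len n by (intro conjI bexI[of _ "W * U'"]) auto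
qed

lemma eigs_splits:
  assumes "char_poly A = (\<Prod>e\<leftarrow>es. [:- e, 1:])"
  shows "eigs A = sort es"
proof -
  have "proots (\<Prod>e\<leftarrow>es. [:- e, 1:]) = mset es"
  proof (induction es)
    case (Cons e es)
    have "(\<Prod>e\<leftarrow>es. [:- e, 1:]) \<noteq> 0" by (auto simp: prod_list_zero_iff)
    then show ?case using Cons by (simp add: proots_mult del: mult_pCons_left)
  qed simp
  then show ?thesis unfolding eigs_def assms by simp
qed

text \<open>The vectors \<open>p i\<close> are the columns of the orthogonal diagonaliser for the
  sorted list of roots, so \<open>p i\<close> belongs to \<open>eigs A ! i\<close>. With both
  products in coordinates, eigenvalue bounds reduce to termwise comparison of sums.\<close>

lemma spectral_theorem:
  fixes A :: "real mat"
  assumes A: "A \<in> carrier_mat n n" and sym: "A\<^sup>T = A"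
  obtains p where "length (eigs A) = n" "sorted (eigs A)"
    "\<And>i. i < n \<Longrightarrow> p i \<in> carrier_vec n"
    "\<And>i j. i < n \<Longrightarrow> j < n \<Longrightarrow> p i \<bullet> p j = (if i = j then 1 else 0)"
    "\<And>u v. u \<in> carrier_vec n \<Longrightarrow> v \<in> carrier_vec n \<Longrightarrow> u \<bullet> v = (\<Sum>i<n. (p i \<bullet> u) * (p i \<bullet> v))"
    "\<And>u v. u \<in> carrier_vec n \<Longrightarrow> v \<in> carrier_vec n \<Longrightarrow>
       u \<bullet> (A *\<^sub>v v) = (\<Sum>i<n. eigs A ! i * (p i \<bullet> u) * (p i \<bullet> v))"
proof -
  obtain es where "char_poly A = (\<Prod>e\<leftarrow>es. [:- e, 1:])"
    by (rule char_poly_symmetric_splits[OF A sym])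
  moreover have "(\<Prod>e\<leftarrow>es. [:- e, 1:]) = (\<Prod>e\<leftarrow>sort es. [:- e, 1:])"
    by (simp flip: prod_mset_prod_list)
  moreover note eigs_splits[of A es]
  ultimately have cp: "char_poly A = (\<Prod>e\<leftarrow>eigs A. [:- e, 1:])" and s: "sorted (eigs A)"
    by (metis, metis sorted_sort)
  let ?D = "mat n n (\<lambda>(i,j). if i = j then eigs A ! i else 0)"
  from orthogonal_diagonalization[OF A sym cp] obtain U where len: "length (eigs A) = n"
    and U: "U \<in> carrier_mat n n" and UU: "U\<^sup>T * U = 1\<^sub>m n" and AU: "A * U = U * ?D" by blast
  have UT: "U\<^sup>T \<in> carrier_mat n n" using U by simp
  have UU': "U * U\<^sup>T = 1\<^sub>m n" using mat_mult_left_right_inverse[OF UT U UU] .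
  have p: "col U i \<in> carrier_vec n" for i using U by (intro carrier_vecI) simp
  have orth: "col U i \<bullet> col U j = (if i = j then 1 else 0)" if "i < n" "j < n" for i j
  proof -
    have "(U\<^sup>T * U) $$ (i,j) = col U i \<bullet> col U j" using U that by simp
    then show ?thesis using that by (simp add: UU)
  qed
  have ip: "u \<bullet> v = (\<Sum>i<n. (col U i \<bullet> u) * (col U i \<bullet> v))"
    if u: "u \<in> carrier_vec n" and v: "v \<in> carrier_vec n" for u v
  proof -
    have "u \<bullet> v = u \<bullet> (U *\<^sub>v (U\<^sup>T *\<^sub>v v))"
      using U UT v UU' by (simp add: assoc_mult_mat_vec[symmetric, of U n n "U\<^sup>T" n v])
    also have "\<dots> = (U\<^sup>T *\<^sub>v u) \<bullet> (U\<^sup>T *\<^sub>v v)"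
      using transpose_vec_mult_scalar[OF U _ u, of "U\<^sup>T *\<^sub>v v"] UT v by simp
    also have "\<dots> = (\<Sum>i<n. (col U i \<bullet> u) * (col U i \<bullet> v))"
      using U u v by (subst scalar_prod_def) (auto simp: lessThan_atLeast0)
    finally show ?thesis .
  qed
  have eig: "col U i \<bullet> (A *\<^sub>v v) = eigs A ! i * (col U i \<bullet> v)"
    if i: "i < n" and v: "v \<in> carrier_vec n" for i v
  proof -
    have "A *\<^sub>v col U i = col (U * ?D) i"
      using A U i AU by (metis col_mult2)
    also have "\<dots> = U *\<^sub>v col ?D i" using U i by (simp add: col_mult2[of U n n ?D n])
    also have "\<dots> = eigs A ! i \<cdot>\<^sub>v col U i"
    proof (rule eq_vecI)
      fix k assume "k < dim_vec (eigs A ! i \<cdot>\<^sub>v col U i)"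
      then have k: "k < n" using U by simp
      have "(U *\<^sub>v col ?D i) $ k = (\<Sum>j = 0..<n. U $$ (k,j) * (if j = i then eigs A ! j else 0))"
        using k i U by (simp add: scalar_prod_def)
      also have "\<dots> = (\<Sum>j = 0..<n. if j = i then U $$ (k,j) * eigs A ! i else 0)"
        by (intro sum.cong) auto
      also have "\<dots> = (eigs A ! i \<cdot>\<^sub>v col U i) $ k" using k i U by (simp add: sum.delta)
      finally show "(U *\<^sub>v col ?D i) $ k = (eigs A ! i \<cdot>\<^sub>v col U i) $ k" .
    qed (use U in auto)
    finally have "v \<bullet> (A *\<^sub>v col U i) = eigs A ! i * (v \<bullet> col U i)"
      using p v by simp
    then show ?thesis
      using symmetric_form_commute[OF A sym p v] comm_scalar_prod[OF p v] by simp
  qed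
  show ?thesis
  proof (rule that[of "col U", OF len s p orth ip])
    fix u v :: "real vec" assume uv: "u \<in> carrier_vec n" "v \<in> carrier_vec n"
    then have "A *\<^sub>v v \<in> carrier_vec n" using A by simp
    then show "u \<bullet> (A *\<^sub>v v) = (\<Sum>i<n. eigs A ! i * (col U i \<bullet> u) * (col U i \<bullet> v))"
      using uv by (subst ip) (auto simp: eig intro!: sum.cong)
  qed
qed

subsection \<open>Extremal eigenvalues and quadratic forms\<close>

lemma eigs_length_symmetric:
  fixes A :: "real mat"
  assumes "A \<in> carrier_mat n n" "A\<^sup>T = A"
  shows "length (eigs A) = n"
  using spectral_theorem[OF assms] by blast

lemma lambda_min_le_lambda_min2:
  fixes A :: "real mat"
  assumes A: "A \<in> carrier_mat n n" "A\<^sup>T = A" and n: "n \<ge> 2"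
  shows "lambda_min A \<le> lambda_min2 A"
proof -
  have "sorted (eigs A)" by (simp add: eigs_def)
  then show ?thesis
    unfolding lambda_min_def lambda_min2_def
    using eigs_length_symmetric[OF A] n by (simp add: sorted_nth_mono)
qed

lemma lambda_min_le:
  fixes A :: "real mat"
  assumes A: "A \<in> carrier_mat n n" "A\<^sup>T = A" and v: "v \<in> carrier_vec n"
  shows "lambda_min A * (v \<bullet> v) \<le> v \<bullet> (A *\<^sub>v v)"
proof -
  obtain p where p: "length (eigs A) = n" "sorted (eigs A)"
    "\<And>u v. u \<in> carrier_vec n \<Longrightarrow> v \<in> carrier_vec n \<Longrightarrow> u \<bullet> v = (\<Sum>i<n. (p i \<bullet> u) * (p i \<bullet> v))"
    "\<And>u v. u \<in> carrier_vec n \<Longrightarrow> v \<in> carrier_vec n \<Longrightarrow>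
       u \<bullet> (A *\<^sub>v v) = (\<Sum>i<n. eigs A ! i * (p i \<bullet> u) * (p i \<bullet> v))"
    by (rule spectral_theorem[OF A]) blast
  have "lambda_min A * (v \<bullet> v) = (\<Sum>i<n. lambda_min A * ((p i \<bullet> v) * (p i \<bullet> v)))"
    by (simp only: p(3)[OF v v] sum_distrib_left)
  also have "\<dots> \<le> (\<Sum>i<n. eigs A ! i * ((p i \<bullet> v) * (p i \<bullet> v)))"
    unfolding lambda_min_def using p(1,2)
    by (intro sum_mono mult_right_mono) (auto intro: sorted_nth_mono)
  also have "\<dots> = v \<bullet> (A *\<^sub>v v)" by (simp only: p(4)[OF v v] mult.assoc)
  finally show ?thesis .
qed

lemma le_lambda_max:
  fixes A :: "real mat"
  assumes A: "A \<in> carrier_mat n n" "A\<^sup>T = A" and v: "v \<in> carrier_vec n"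
  shows "v \<bullet> (A *\<^sub>v v) \<le> lambda_max A * (v \<bullet> v)"
proof -
  obtain p where p: "length (eigs A) = n" "sorted (eigs A)"
    "\<And>u v. u \<in> carrier_vec n \<Longrightarrow> v \<in> carrier_vec n \<Longrightarrow> u \<bullet> v = (\<Sum>i<n. (p i \<bullet> u) * (p i \<bullet> v))"
    "\<And>u v. u \<in> carrier_vec n \<Longrightarrow> v \<in> carrier_vec n \<Longrightarrow>
       u \<bullet> (A *\<^sub>v v) = (\<Sum>i<n. eigs A ! i * (p i \<bullet> u) * (p i \<bullet> v))"
    by (rule spectral_theorem[OF A]) blast
  have le: "eigs A ! i \<le> last (eigs A)" if "i < n" for i
  proof -
    have "eigs A \<noteq> []" using that p(1) by auto
    then show ?thesis using that p(1,2) by (auto simp: last_conv_nth intro: sorted_nth_mono)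
  qed
  have "v \<bullet> (A *\<^sub>v v) = (\<Sum>i<n. eigs A ! i * ((p i \<bullet> v) * (p i \<bullet> v)))"
    by (simp only: p(4)[OF v v] mult.assoc)
  also have "\<dots> \<le> (\<Sum>i<n. lambda_max A * ((p i \<bullet> v) * (p i \<bullet> v)))"
    unfolding lambda_max_def using le by (intro sum_mono mult_right_mono) auto
  also have "\<dots> = lambda_max A * (v \<bullet> v)"
    by (simp only: p(3)[OF v v] sum_distrib_left)
  finally show ?thesis .
qed

lemma lambda_min_attained:
  fixes A :: "real mat"
  assumes A: "A \<in> carrier_mat n n" "A\<^sup>T = A" and n: "n > 0"
  obtains v where "v \<in> carrier_vec n" "v \<bullet> v = 1" "v \<bullet> (A *\<^sub>v v) = lambda_min A"
proof -
  obtain p where p: "\<And>i. i < n \<Longrightarrow> p i \<in> carrier_vec n"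
    "\<And>i j. i < n \<Longrightarrow> j < n \<Longrightarrow> p i \<bullet> p j = (if i = j then 1 else 0)"
    "\<And>u v. u \<in> carrier_vec n \<Longrightarrow> v \<in> carrier_vec n \<Longrightarrow>
       u \<bullet> (A *\<^sub>v v) = (\<Sum>i<n. eigs A ! i * (p i \<bullet> u) * (p i \<bullet> v))"
    by (rule spectral_theorem[OF A]) blast
  have "p 0 \<bullet> (A *\<^sub>v p 0) = (\<Sum>i<n. if i = 0 then eigs A ! 0 else 0)"
    unfolding p(3)[OF p(1)[OF n] p(1)[OF n]] using n by (intro sum.cong) (auto simp: p(2))
  then show ?thesis
    using that[of "p 0"] p(1)[OF n] p(2)[OF n n] n by (simp add: lambda_min_def)
qed

text \<open>The first two eigenvectors. When \<open>lambda_min2 A\<close> is at most 0 and the form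
  is nonnegative, both are zeros of the form, which is how the lemma is used.\<close>

lemma lambda_min2_subspace:
  fixes A :: "real mat"
  assumes A: "A \<in> carrier_mat n n" "A\<^sup>T = A" and n: "n \<ge> 2"
  obtains u v where "u \<in> carrier_vec n" "v \<in> carrier_vec n" "u \<bullet> u = 1" "v \<bullet> v = 1" "u \<bullet> v = 0"
    "u \<bullet> (A *\<^sub>v u) \<le> lambda_min2 A" "v \<bullet> (A *\<^sub>v v) \<le> lambda_min2 A"
proof -
  obtain p where p: "\<And>i. i < n \<Longrightarrow> p i \<in> carrier_vec n"
    "\<And>i j. i < n \<Longrightarrow> j < n \<Longrightarrow> p i \<bullet> p j = (if i = j then 1 else 0)"
    "\<And>u v. u \<in> carrier_vec n \<Longrightarrow> v \<in> carrier_vec n \<Longrightarrow>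
       u \<bullet> (A *\<^sub>v v) = (\<Sum>i<n. eigs A ! i * (p i \<bullet> u) * (p i \<bullet> v))"
    by (rule spectral_theorem[OF A]) blast
  have e: "p k \<bullet> (A *\<^sub>v p k) = eigs A ! k" if k: "k < n" for k
  proof -
    have "p k \<bullet> (A *\<^sub>v p k) = (\<Sum>i<n. if i = k then eigs A ! k else 0)"
      unfolding p(3)[OF p(1)[OF k] p(1)[OF k]] using k by (intro sum.cong) (auto simp: p(2))
    then show ?thesis using k by simp
  qed
  have k: "0 < n" "1 < n" using n by auto
  show ?thesis
    using that[OF p(1)[OF k(1)] p(1)[OF k(2)]] p(2)[OF k(1) k(1)] p(2)[OF k(2) k(2)] p(2)[OF k(1) k(2)]
      e[OF k(1)] e[OF k(2)] lambda_min_le_lambda_min2[OF A n] by (simp add: lambda_min_def lambda_min2_def)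
qed

text \<open>Equality in the Rayleigh bound leaves \<open>h\<close> only components with the least
  eigenvalue, so \<open>h\<close> is an eigenvector. If that eigenvalue is simple, \<open>h\<close>
  is a multiple of \<open>p 0\<close> and vectors orthogonal to it have no \<open>p 0\<close>
  component; if it is not, the bound by \<open>lambda_min2\<close> is the Rayleigh bound
  itself.\<close>

lemma lambda_min_vector:
  fixes A :: "real mat"
  assumes A: "A \<in> carrier_mat n n" "A\<^sup>T = A"
    and h: "h \<in> carrier_vec n" "h \<bullet> (A *\<^sub>v h) = lambda_min A * (h \<bullet> h)"
    and u: "u \<in> carrier_vec n"
  shows "h \<bullet> (A *\<^sub>v u) = lambda_min A * (h \<bullet> u)"
    and "h \<bullet> h = 1 \<Longrightarrow> h \<bullet> u = 0 \<Longrightarrow> n \<ge> 2 \<Longrightarrow> lambda_min2 A * (u \<bullet> u) \<le> u \<bullet> (A *\<^sub>v u)"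
proof -
  obtain p where p: "length (eigs A) = n" "sorted (eigs A)"
    "\<And>u v. u \<in> carrier_vec n \<Longrightarrow> v \<in> carrier_vec n \<Longrightarrow> u \<bullet> v = (\<Sum>i<n. (p i \<bullet> u) * (p i \<bullet> v))"
    "\<And>u v. u \<in> carrier_vec n \<Longrightarrow> v \<in> carrier_vec n \<Longrightarrow>
       u \<bullet> (A *\<^sub>v v) = (\<Sum>i<n. eigs A ! i * (p i \<bullet> u) * (p i \<bullet> v))"
    by (rule spectral_theorem[OF A]) blast
  have le: "lambda_min A \<le> eigs A ! i" if "i < n" for i
    unfolding lambda_min_def using that p(1,2) by (auto intro: sorted_nth_mono)
  have "(\<Sum>i<n. (eigs A ! i - lambda_min A) * (p i \<bullet> h)\<^sup>2) = h \<bullet> (A *\<^sub>v h) - lambda_min A * (h \<bullet> h)"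
    unfolding p(4)[OF h(1) h(1)] p(3)[OF h(1) h(1)] sum_distrib_left sum_subtractf[symmetric]
    by (intro sum.cong) (auto simp: power2_eq_square algebra_simps)
  then have "(\<Sum>i<n. (eigs A ! i - lambda_min A) * (p i \<bullet> h)\<^sup>2) = 0" using h(2) by simp
  then have z: "(eigs A ! i - lambda_min A) * (p i \<bullet> h) = 0" if "i < n" for i
    using that le by (subst (asm) sum_nonneg_eq_0_iff) auto
  show "h \<bullet> (A *\<^sub>v u) = lambda_min A * (h \<bullet> u)"
    unfolding p(4)[OF h(1) u] p(3)[OF h(1) u] sum_distrib_left
    using z by (intro sum.cong) (auto simp: algebra_simps)
  assume hh: "h \<bullet> h = 1" and hu: "h \<bullet> u = 0" and n: "n \<ge> 2"
  show "lambda_min2 A * (u \<bullet> u) \<le> u \<bullet> (A *\<^sub>v u)"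
  proof (cases "lambda_min2 A = lambda_min A")
    case True
    then show ?thesis using lambda_min_le[OF A u] by simp
  next
    case False
    have le2: "lambda_min2 A \<le> eigs A ! i" if "i < n" "i > 0" for i
      unfolding lambda_min2_def using that p(1,2) by (auto intro: sorted_nth_mono)
    have gt: "lambda_min2 A > lambda_min A" using lambda_min_le_lambda_min2[OF A n] False by simp
    have z': "p i \<bullet> h = 0" if "i < n" "i > 0" for i
      using z[OF that(1)] le2[OF that] gt by auto
    have only0: "h \<bullet> w = (p 0 \<bullet> h) * (p 0 \<bullet> w)" if w: "w \<in> carrier_vec n" for w
    proof -
      have "h \<bullet> w = (\<Sum>i<n. if i = 0 then (p 0 \<bullet> h) * (p 0 \<bullet> w) else 0)"
        unfolding p(3)[OF h(1) w] using z' by (intro sum.cong) auto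
      then show ?thesis using n by simp
    qed
    have pu: "p 0 \<bullet> u = 0" using only0[OF h(1)] only0[OF u] hh hu by auto
    have "lambda_min2 A * (u \<bullet> u) = (\<Sum>i<n. lambda_min2 A * ((p i \<bullet> u) * (p i \<bullet> u)))"
      by (simp only: p(3)[OF u u] sum_distrib_left)
    also have "\<dots> \<le> (\<Sum>i<n. eigs A ! i * ((p i \<bullet> u) * (p i \<bullet> u)))"
    proof (rule sum_mono)
      fix i assume "i \<in> {..<n}"
      then show "lambda_min2 A * ((p i \<bullet> u) * (p i \<bullet> u)) \<le> eigs A ! i * ((p i \<bullet> u) * (p i \<bullet> u))"
        using pu le2[of i] by (cases "i = 0") (auto intro: mult_right_mono)
    qed
    also have "\<dots> = u \<bullet> (A *\<^sub>v u)" by (simp only: p(4)[OF u u] mult.assoc)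
    finally show ?thesis .
  qed
qed

subsection \<open>Rotation residuals as quaternion forms\<close>

lemma scalar_prod_4:
  "v \<in> carrier_vec 4 \<Longrightarrow> u \<bullet> v = u $ 0 * v $ 0 + u $ 1 * v $ 1 + u $ 2 * v $ 2 + u $ 3 * v $ 3"
  by (simp add: scalar_prod_def eval_nat_numeral)

lemma scalar_prod_3:
  "v \<in> carrier_vec 3 \<Longrightarrow> u \<bullet> v = u $ 0 * v $ 0 + u $ 1 * v $ 1 + u $ 2 * v $ 2"
  by (simp add: scalar_prod_def eval_nat_numeral)

lemma sum_upto_4: "(\<Sum>i<(4::nat). f i) = f 0 + f 1 + f 2 + f 3"
  for f :: "nat \<Rightarrow> 'a :: comm_monoid_add"
  by (simp add: eval_nat_numeral add_ac)

lemma eq_vec4I: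
  assumes "u \<in> carrier_vec 4" "v \<in> carrier_vec 4"
    "u $ 0 = v $ 0" "u $ 1 = v $ 1" "u $ 2 = v $ 2" "u $ 3 = v $ 3"
  shows "u = v"
proof (rule eq_vecI)
  fix i assume "i < dim_vec v"
  then have "i = 0 \<or> i = 1 \<or> i = 2 \<or> i = 3" using assms by auto
  then show "u $ i = v $ i" using assms by auto
qed (use assms in auto)

lemma sq_vnorm: "(vnorm v)\<^sup>2 = v \<bullet> v"
proof -
  have "v \<bullet> v \<ge> 0" by (simp add: scalar_prod_def sum_nonneg)
  then show ?thesis by (simp add: vnorm_def)
qed

lemma sphere3_iff: "w \<in> sphere3 \<longleftrightarrow> w \<in> carrier_vec 4 \<and> w \<bullet> w = 1"
  unfolding sphere3_def vnorm_def carrier_vec_def by auto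

section \<open>Quaternion arithmetic in coordinates\<close>

definition qmul :: "real vec \<Rightarrow> real vec \<Rightarrow> real vec" where
  "qmul a b = vec_of_list
    [a$0 * b$0 - a$1 * b$1 - a$2 * b$2 - a$3 * b$3,
     a$0 * b$1 + a$1 * b$0 + a$2 * b$3 - a$3 * b$2,
     a$0 * b$2 - a$1 * b$3 + a$2 * b$0 + a$3 * b$1,
     a$0 * b$3 + a$1 * b$2 - a$2 * b$1 + a$3 * b$0]"

definition qconj :: "real vec \<Rightarrow> real vec" where
  "qconj a = vec_of_list [a$0, - a$1, - a$2, - a$3]"

definition pure_quat :: "real vec \<Rightarrow> real vec" where
  "pure_quat x = vec_of_list [0, x$0, x$1, x$2]"

text \<open>Index 1 is written \<open>Suc 0\<close>, the form that the simplifier gives it.\<close>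

lemma qmul_index [simp]:
  "qmul a b $ 0 = a$0 * b$0 - a$1 * b$1 - a$2 * b$2 - a$3 * b$3"
  "qmul a b $ Suc 0 = a$0 * b$1 + a$1 * b$0 + a$2 * b$3 - a$3 * b$2"
  "qmul a b $ 2 = a$0 * b$2 - a$1 * b$3 + a$2 * b$0 + a$3 * b$1"
  "qmul a b $ 3 = a$0 * b$3 + a$1 * b$2 - a$2 * b$1 + a$3 * b$0"
  by (simp_all add: qmul_def eval_nat_numeral)

lemma qconj_index [simp]:
  "qconj a $ 0 = a$0" "qconj a $ Suc 0 = - a$1" "qconj a $ 2 = - a$2" "qconj a $ 3 = - a$3"
  by (simp_all add: qconj_def eval_nat_numeral)

lemma pure_quat_index [simp]:
  "pure_quat x $ 0 = 0" "pure_quat x $ Suc 0 = x$0" "pure_quat x $ 2 = x$1" "pure_quat x $ 3 = x$2"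
  by (simp_all add: pure_quat_def eval_nat_numeral)

lemma quat_carrier [simp]:
  "qmul a b \<in> carrier_vec 4" "qconj a \<in> carrier_vec 4" "pure_quat x \<in> carrier_vec 4"
  by (auto simp: qmul_def qconj_def pure_quat_def intro!: carrier_vecI)

lemma quat_dim [simp]: "dim_vec (qmul a b) = 4" "dim_vec (qconj a) = 4" "dim_vec (pure_quat x) = 4"
  by (simp_all add: qmul_def qconj_def pure_quat_def)

lemma qmul_assoc: "qmul (qmul a b) c = qmul a (qmul b c)"
  by (rule eq_vec4I) (simp_all add: algebra_simps)

lemma qmul_diff_left:
  "a \<in> carrier_vec 4 \<Longrightarrow> b \<in> carrier_vec 4 \<Longrightarrow> qmul (a - b) c = qmul a c - qmul b c"
  by (rule eq_vec4I) (auto simp: algebra_simps)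

text \<open>Euler's four-square identity.\<close>

lemma qmul_norm: "qmul a b \<bullet> qmul a b = (a$0^2 + a$1^2 + a$2^2 + a$3^2) * (b$0^2 + b$1^2 + b$2^2 + b$3^2)"
  by (simp add: scalar_prod_4 power2_eq_square algebra_simps)

lemma qmul_qconj_cancel:
  assumes "u \<in> carrier_vec 4" "v \<in> carrier_vec 4"
  shows "qmul u (qmul (qconj u) v) = (u \<bullet> u) \<cdot>\<^sub>v v" "qmul (qconj u) (qmul u v) = (u \<bullet> u) \<cdot>\<^sub>v v"
  using assms by (intro eq_vec4I; simp add: scalar_prod_4 algebra_simps)+

text \<open>For unit \<open>w\<close> the vector \<open>rotq w *\<^sub>v x\<close> is the quaternion
  product w x w^-1. Multiplying the residual y - w x w^-1 by \<open>w\<close> on the right keeps its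
  length and makes it linear in \<open>w\<close>.\<close>

definition quat_resid :: "real vec \<Rightarrow> real vec \<Rightarrow> real vec \<Rightarrow> real vec" where
  "quat_resid y x w = qmul (pure_quat y) w - qmul w (pure_quat x)"

lemma quat_resid_carrier [simp]: "quat_resid y x w \<in> carrier_vec 4"
  by (simp add: quat_resid_def)

text \<open>The Gram matrix of the images of the unit vectors under the linear map
  \<open>quat_resid y x\<close>, hence symmetric and positive semidefinite by construction.\<close>

definition quat_form :: "real vec \<Rightarrow> real vec \<Rightarrow> real mat" where
  "quat_form y x = mat 4 4 (\<lambda>(i,j). quat_resid y x (unit_vec 4 i) \<bullet> quat_resid y x (unit_vec 4 j))"

lemma quat_form_carrier [simp]: "quat_form y x \<in> carrier_mat 4 4"
  by (simp add: quat_form_def)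

lemma quat_form_symmetric: "(quat_form y x)\<^sup>T = quat_form y x"
  by (rule eq_matI) (auto simp: quat_form_def comm_scalar_prod[OF quat_resid_carrier quat_resid_carrier])

lemma quat_form_form:
  assumes w: "w \<in> carrier_vec 4"
  shows "w \<bullet> (quat_form y x *\<^sub>v w) = quat_resid y x w \<bullet> quat_resid y x w"
proof -
  let ?r = "\<lambda>i k. quat_resid y x (unit_vec 4 i) $ k"
  have r: "quat_resid y x w $ k = (\<Sum>i<4. w $ i * ?r i k)" if "k < 4" for k
  proof -
    have "k = 0 \<or> k = 1 \<or> k = 2 \<or> k = 3" using that by auto
    then show ?thesis
      by (elim disjE; simp only: One_nat_def; simp add: sum_upto_4 quat_resid_def; simp add: algebra_simps)
  qed
  have "quat_resid y x w \<bullet> quat_resid y x w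
      = (\<Sum>k<4. (\<Sum>i<4. w $ i * ?r i k) * (\<Sum>j<4. w $ j * ?r j k))"
    unfolding scalar_prod_def using r by (simp add: lessThan_atLeast0 carrier_vecD[OF quat_resid_carrier])
  also have "\<dots> = (\<Sum>k<4. \<Sum>i<4. \<Sum>j<4. w $ i * w $ j * (?r i k * ?r j k))"
    by (simp add: sum_product mult_ac)
  also have "\<dots> = (\<Sum>i<4. \<Sum>k<4. \<Sum>j<4. w $ i * w $ j * (?r i k * ?r j k))"
    by (rule sum.swap)
  also have "\<dots> = (\<Sum>i<4. \<Sum>j<4. \<Sum>k<4. w $ i * w $ j * (?r i k * ?r j k))"
    by (intro sum.cong refl sum.swap)
  also have "\<dots> = w \<bullet> (quat_form y x *\<^sub>v w)"
    using w by (simp add: scalar_prod_def quat_form_def lessThan_atLeast0 carrier_vecD[OF quat_resid_carrier] sum_distrib_left mult_ac)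
  finally show ?thesis by simp
qed

section \<open>Polynomial identities for rotation by a quaternion\<close>

lemma rotation_norm_identity:
  fixes a b c d x0 x1 x2 :: real
  shows "((a^2 + b^2 - c^2 - d^2) * x0 + 2*(b*c - a*d) * x1 + 2*(b*d + a*c) * x2)^2
    + (2*(b*c + a*d) * x0 + (a^2 + c^2 - b^2 - d^2) * x1 + 2*(c*d - a*b) * x2)^2
    + (2*(b*d - a*c) * x0 + 2*(d*c + a*b) * x1 + (a^2 + d^2 - b^2 - c^2) * x2)^2
    = (a^2 + b^2 + c^2 + d^2)^2 * (x0^2 + x1^2 + x2^2)"
  by (simp add: power2_eq_square algebra_simps)

text \<open>With N the squared norm of the quaternion, X and Y those of the data and p the product
  of y with the rotated x, the left side is Y + N^2 X - 2 p and the right side N Y + N X - 2 p. They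
  agree for N = 1.\<close>

lemma rotation_residual_identity:
  fixes a b c d x0 x1 x2 y0 y1 y2 :: real
  defines "r0 \<equiv> (a^2 + b^2 - c^2 - d^2) * x0 + 2*(b*c - a*d) * x1 + 2*(b*d + a*c) * x2"
    and "r1 \<equiv> 2*(b*c + a*d) * x0 + (a^2 + c^2 - b^2 - d^2) * x1 + 2*(c*d - a*b) * x2"
    and "r2 \<equiv> 2*(b*d - a*c) * x0 + 2*(d*c + a*b) * x1 + (a^2 + d^2 - b^2 - c^2) * x2"
  assumes n: "a^2 + b^2 + c^2 + d^2 = 1"
  shows "(y0 - r0)^2 + (y1 - r1)^2 + (y2 - r2)^2
    = (- y0*b - y1*c - y2*d + b*x0 + c*x1 + d*x2)^2
      + (y0*a + y1*d - y2*c - a*x0 - c*x2 + d*x1)^2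
      + (y1*a - y0*d + y2*b - a*x1 + b*x2 - d*x0)^2
      + (y0*c - y1*b + y2*a - a*x2 - b*x1 + c*x0)^2" (is "_ = ?R")
proof -
  let ?N = "a^2 + b^2 + c^2 + d^2" and ?p = "y0*r0 + y1*r1 + y2*r2"
  let ?X = "x0^2 + x1^2 + x2^2" and ?Y = "y0^2 + y1^2 + y2^2"
  have "r0^2 + r1^2 + r2^2 = ?N^2 * ?X"
    unfolding r0_def r1_def r2_def by (rule rotation_norm_identity)
  moreover have "?R = ?N * ?Y + ?N * ?X - 2 * ?p"
    unfolding r0_def r1_def r2_def by (simp add: power2_eq_square algebra_simps)
  moreover have "(y0 - r0)^2 + (y1 - r1)^2 + (y2 - r2)^2 = ?Y + (r0^2 + r1^2 + r2^2) - 2 * ?p"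
    by (simp add: power2_eq_square algebra_simps)
  ultimately show ?thesis by (simp add: n)
qed

lemma rotq_carrier [simp]: "rotq w \<in> carrier_mat 3 3"
  by (auto simp: rotq_def Let_def mat_of_rows_list_def)

lemma rotq_mult_index:
  fixes w x :: "real vec"
  defines "a \<equiv> w$0" and "b \<equiv> w$1" and "c \<equiv> w$2" and "d \<equiv> w$3"
  assumes x: "x \<in> carrier_vec 3"
  shows "(rotq w *\<^sub>v x) $ 0 = (a^2 + b^2 - c^2 - d^2) * x$0 + 2*(b*c - a*d) * x$1 + 2*(b*d + a*c) * x$2"
    "(rotq w *\<^sub>v x) $ 1 = 2*(b*c + a*d) * x$0 + (a^2 + c^2 - b^2 - d^2) * x$1 + 2*(c*d - a*b) * x$2"
    "(rotq w *\<^sub>v x) $ 2 = 2*(b*d - a*c) * x$0 + 2*(d*c + a*b) * x$1 + (a^2 + d^2 - b^2 - c^2) * x$2"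
  using x unfolding a_def b_def c_def d_def
  by (simp_all add: rotq_def Let_def mat_of_rows_list_def scalar_prod_3 row_def eval_nat_numeral)

lemma rotq_norm:
  assumes w: "w \<in> sphere3" and x: "x \<in> carrier_vec 3"
  shows "vnorm (rotq w *\<^sub>v x) = vnorm x"
proof -
  have Rx: "rotq w *\<^sub>v x \<in> carrier_vec 3" using mult_mat_vec_carrier[OF rotq_carrier x] .
  have w4: "w \<in> carrier_vec 4" and ww: "w \<bullet> w = 1" using w by (auto simp: sphere3_iff)
  have n: "(w$0)^2 + (w$1)^2 + (w$2)^2 + (w$3)^2 = 1"
    using ww by (simp add: scalar_prod_4[OF w4] power2_eq_square)
  have "(rotq w *\<^sub>v x) \<bullet> (rotq w *\<^sub>v x) = x \<bullet> x"
    unfolding scalar_prod_3[OF Rx] scalar_prod_3[OF x] unfolding rotq_mult_index[OF x] power2_eq_square[symmetric]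
    unfolding rotation_norm_identity n by simp
  then show ?thesis by (simp add: vnorm_def)
qed

lemma rotq_residual:
  assumes w: "w \<in> sphere3" and y: "y \<in> carrier_vec 3" and x: "x \<in> carrier_vec 3"
  shows "(vnorm (y - rotq w *\<^sub>v x))\<^sup>2 = quat_resid y x w \<bullet> quat_resid y x w"
proof -
  have Rx: "rotq w *\<^sub>v x \<in> carrier_vec 3" using mult_mat_vec_carrier[OF rotq_carrier x] .
  have w4: "w \<in> carrier_vec 4" and ww: "w \<bullet> w = 1" using w by (auto simp: sphere3_iff)
  have n: "(w$0)^2 + (w$1)^2 + (w$2)^2 + (w$3)^2 = 1"
    using ww by (simp add: scalar_prod_4[OF w4] power2_eq_square)
  have "(vnorm (y - rotq w *\<^sub>v x))\<^sup>2 = (y$0 - (rotq w *\<^sub>v x)$0)^2 + (y$1 - (rotq w *\<^sub>v x)$1)^2 + (y$2 - (rotq w *\<^sub>v x)$2)^2"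
    using y Rx carrier_vecD[OF Rx] unfolding sq_vnorm
    by (subst scalar_prod_3) (auto simp: power2_eq_square)
  also have "\<dots> = quat_resid y x w \<bullet> quat_resid y x w"
    unfolding rotq_mult_index[OF x] rotation_residual_identity[OF n]
    unfolding scalar_prod_4[OF quat_resid_carrier]
    by (simp add: quat_resid_def power2_eq_square) (simp add: algebra_simps)
  finally show ?thesis .
qed

text \<open>This gives the uniqueness behind \<open>THE\<close> in \<open>quad_rep\<close>.
  Homogeneity extends the agreement from unit vectors to all vectors, and the values at sums of two
  coordinate vectors recover the entries by polarisation.\<close>

lemma symmetric_forms_eq:
  fixes M N :: "real mat"
  assumes M: "M \<in> carrier_mat n n" "M\<^sup>T = M" and N: "N \<in> carrier_mat n n" "N\<^sup>T = N"
    and eq: "\<And>w. w \<in> carrier_vec n \<Longrightarrow> w \<bullet> w = 1 \<Longrightarrow> w \<bullet> (M *\<^sub>v w) = w \<bullet> (N *\<^sub>v w)"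
  shows "M = N"
proof -
  have all: "w \<bullet> (M *\<^sub>v w) = w \<bullet> (N *\<^sub>v w)" if w: "w \<in> carrier_vec n" for w
  proof (cases "w = 0\<^sub>v n")
    case True
    then show ?thesis using M N by simp
  next
    case False
    let ?c = "1 / sqrt (w \<bullet> w)"
    have pos: "w \<bullet> w > 0" using conjugate_square_greater_0_vec[OF w] False
      by (metis conjugate_real_vec)
    have "(?c \<cdot>\<^sub>v w) \<bullet> (M *\<^sub>v (?c \<cdot>\<^sub>v w)) = (?c \<cdot>\<^sub>v w) \<bullet> (N *\<^sub>v (?c \<cdot>\<^sub>v w))"
      using w pos by (intro eq) (auto simp: divide_simps)
    then show ?thesis using w pos M N by (simp add: mult_mat_vec)
  qed
  have form: "(unit_vec n i + unit_vec n j) \<bullet> (A *\<^sub>v (unit_vec n i + unit_vec n j)) = A$$(i,i) + 2 * A$$(i,j) + A$$(j,j)"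
    if A: "A \<in> carrier_mat n n" "A\<^sup>T = A" and ij: "i < n" "j < n" for A :: "real mat" and i j
  proof -
    have "A $$ (j,i) = A $$ (i,j)" using A ij by (metis carrier_matD index_transpose_mat(1))
    moreover have "unit_vec n a \<bullet> (A *\<^sub>v unit_vec n b) = A $$ (a,b)" if "a < n" "b < n" for a b
      using A that by (simp add: mult_mat_vec_def scalar_prod_left_unit scalar_prod_right_unit)
    ultimately show ?thesis
      using A ij by (simp add: mult_add_distrib_mat_vec[of A n n] add_scalar_prod_distrib[of _ n] scalar_prod_add_distrib[of _ n])
  qed
  show ?thesis
  proof (rule eq_matI)
    fix i j assume "i < dim_row N" "j < dim_col N"
    then have ij: "i < n" "j < n" using N by auto
    \<comment> \<open>Taking both indices equal isolates four times a diagonal entry; the mixed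
      entry then follows by subtraction.\<close>
    have d: "M $$ (k,k) = N $$ (k,k)" if "k < n" for k
      using all[of "unit_vec n k + unit_vec n k"] form[OF M that that] form[OF N that that] by simp
    show "M $$ (i,j) = N $$ (i,j)"
      using all[of "unit_vec n i + unit_vec n j"] form[OF M ij] form[OF N ij] d ij by simp
  qed (use M N in auto)
qed

lemma Qmat_eq_quat_form:
  assumes "y \<in> carrier_vec 3" "x \<in> carrier_vec 3"
  shows "Qmat y x = quat_form y x"
  unfolding Qmat_def quad_rep_def
proof (rule the_equality)
  show "quat_form y x \<in> carrier_mat 4 4 \<and> (quat_form y x)\<^sup>T = quat_form y x \<and>
    (\<forall>w\<in>sphere3. w \<bullet> (quat_form y x *\<^sub>v w) = (vnorm (y - rotq w *\<^sub>v x))\<^sup>2)"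
    using assms by (auto simp: quat_form_symmetric rotq_residual quat_form_form sphere3_iff)
next
  fix M assume M: "M \<in> carrier_mat 4 4 \<and> M\<^sup>T = M \<and>
    (\<forall>w\<in>sphere3. w \<bullet> (M *\<^sub>v w) = (vnorm (y - rotq w *\<^sub>v x))\<^sup>2)"
  show "M = quat_form y x"
  proof (rule symmetric_forms_eq)
    fix w :: "real vec" assume "w \<in> carrier_vec 4" "w \<bullet> w = 1"
    then have "w \<in> sphere3" "w \<in> carrier_vec 4" by (auto simp: sphere3_iff)
    then show "w \<bullet> (M *\<^sub>v w) = w \<bullet> (quat_form y x *\<^sub>v w)"
      using M assms by (simp add: rotq_residual quat_form_form)
  qed (use M quat_form_symmetric in auto)
qed

section \<open>Right multiplications that preserve the residual forms\<close>

lemma quat_resid_mult_right: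
  assumes comm: "qmul g (pure_quat x) = qmul (pure_quat x) g"
  shows "quat_resid y x (qmul w g) = qmul (quat_resid y x w) g"
  unfolding quat_resid_def by (simp add: qmul_diff_left qmul_assoc comm)

text \<open>The zero residuals say y u = u x and y v = v x. With \<open>?g\<close> the conjugate of
  \<open>u\<close> times \<open>v\<close>, so that u g = v, this gives u (g x) = v x = y v = y u g =
  u (x g), and the unit \<open>u\<close> cancels.\<close>

lemma quat_resid_zeros_commute:
  assumes u: "u \<in> carrier_vec 4" "u \<bullet> u = 1" and v: "v \<in> carrier_vec 4"
    and zu: "quat_resid y x u = 0\<^sub>v 4" and zv: "quat_resid y x v = 0\<^sub>v 4"
  shows "qmul (qmul (qconj u) v) (pure_quat x) = qmul (pure_quat x) (qmul (qconj u) v)"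
proof -
  let ?g = "qmul (qconj u) v"
  have diff0: "a = b" if "a - b = 0\<^sub>v 4" "a \<in> carrier_vec 4" "b \<in> carrier_vec 4" for a b :: "real vec"
  proof (rule eq_vecI)
    fix i assume "i < dim_vec b"
    then have i: "i < 4" using that by auto
    have "a $ i - b $ i = (a - b) $ i" using that(2,3) i by simp
    also have "\<dots> = 0" unfolding that(1) using i by simp
    finally show "a $ i = b $ i" by simp
  qed (use that in auto)
  have eu: "qmul (pure_quat y) u = qmul u (pure_quat x)" and ev: "qmul (pure_quat y) v = qmul v (pure_quat x)"
    using zu zv diff0 by (auto simp: quat_resid_def)
  have ug: "qmul u ?g = v" using qmul_qconj_cancel(1)[OF u(1) v] u(2) v by simp
  have cu: "qmul (qconj u) (qmul u a) = a" if "a \<in> carrier_vec 4" for a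
    using qmul_qconj_cancel(2)[OF u(1) that] u(2) that by simp
  have "qmul u (qmul ?g (pure_quat x)) = qmul (qmul (pure_quat y) u) ?g"
    using ev ug by (simp add: qmul_assoc[symmetric]) (metis qmul_assoc)
  also have "\<dots> = qmul u (qmul (pure_quat x) ?g)" by (simp add: eu qmul_assoc)
  finally show ?thesis using cu by (metis quat_carrier(1))
qed

text \<open>\<open>J\<close> is right multiplication by \<open>g = qmul (qconj u) v\<close>. Since
  \<open>u\<close> and \<open>v\<close> are orthonormal, \<open>g\<close> is a unit quaternion with
  zero real part, so \<open>J\<close> sends each vector to an orthogonal one of the same length.
  That \<open>g\<close> commutes with \<open>x\<close> does not involve the target, which is why
  \<open>y\<close> may differ from \<open>z\<close>.\<close>

lemma quat_form_mult_right:
  assumes u: "u \<in> carrier_vec 4" "u \<bullet> u = 1" and v: "v \<in> carrier_vec 4" "v \<bullet> v = 1" "u \<bullet> v = 0"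
  obtains J where "\<And>w. w \<in> carrier_vec 4 \<Longrightarrow> J w \<in> carrier_vec 4"
    "\<And>w. w \<in> carrier_vec 4 \<Longrightarrow> w \<bullet> w = 1 \<Longrightarrow> J w \<bullet> J w = 1 \<and> w \<bullet> J w = 0"
    "\<And>z y x w. w \<in> carrier_vec 4 \<Longrightarrow> u \<bullet> (quat_form z x *\<^sub>v u) = 0 \<Longrightarrow> v \<bullet> (quat_form z x *\<^sub>v v) = 0 \<Longrightarrow>
      J w \<bullet> (quat_form y x *\<^sub>v J w) = w \<bullet> (quat_form y x *\<^sub>v w)"
proof -
  define g where "g = qmul (qconj u) v"
  have norm: "qmul a b \<bullet> qmul a b = (a \<bullet> a) * (b \<bullet> b)" if "a \<in> carrier_vec 4" "b \<in> carrier_vec 4" for a b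
    using that by (simp add: qmul_norm scalar_prod_4 power2_eq_square)
  have g: "g \<in> carrier_vec 4" "g $ 0 = 0" "g \<bullet> g = 1"
    using u v norm[of "qconj u" v] by (auto simp: g_def scalar_prod_4)
  have zero: "quat_resid z x a = 0\<^sub>v 4" if "a \<in> carrier_vec 4" "a \<bullet> (quat_form z x *\<^sub>v a) = 0" for z x a
    using that conjugate_square_eq_0_vec[OF quat_resid_carrier, of z x a] by (simp add: quat_form_form)
  show ?thesis
  proof (rule that[of "\<lambda>w. qmul w g"])
    fix w :: "real vec" assume w: "w \<in> carrier_vec 4" "w \<bullet> w = 1"
    have "w \<bullet> qmul w g = g $ 0 * (w \<bullet> w)" using w(1) by (simp add: scalar_prod_4 algebra_simps)
    then show "qmul w g \<bullet> qmul w g = 1 \<and> w \<bullet> qmul w g = 0" using norm[OF w(1) g(1)] w g by simp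
  next
    fix z y x w :: "real vec" assume w: "w \<in> carrier_vec 4" and
      0: "u \<bullet> (quat_form z x *\<^sub>v u) = 0" "v \<bullet> (quat_form z x *\<^sub>v v) = 0"
    have "qmul g (pure_quat x) = qmul (pure_quat x) g"
      unfolding g_def using quat_resid_zeros_commute[OF u v(1)] zero[OF u(1) 0(1)] zero[OF v(1) 0(2)] by blast
    then show "qmul w g \<bullet> (quat_form y x *\<^sub>v qmul w g) = w \<bullet> (quat_form y x *\<^sub>v w)"
      using w norm[OF quat_resid_carrier g(1)] g by (simp add: quat_form_form quat_resid_mult_right)
  qed simp
qed

subsection \<open>Block structure of the semidefinite relaxation\<close>

text \<open>The trace inner product, \<open>tr (A\<^sup>T B)\<close> for matrices of equal
  size.\<close>

definition frob :: "real mat \<Rightarrow> real mat \<Rightarrow> real" where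
  "frob A B = (\<Sum>r<dim_row A. \<Sum>s<dim_col A. A $$ (r,s) * B $$ (r,s))"

lemma form_eq_double_sum:
  fixes A :: "'a :: comm_semiring_0 mat"
  assumes "A \<in> carrier_mat n n" "u \<in> carrier_vec n" "v \<in> carrier_vec n"
  shows "u \<bullet> (A *\<^sub>v v) = (\<Sum>r<n. \<Sum>s<n. A $$ (r,s) * (u $ r * v $ s))"
  using assms by (auto simp: scalar_prod_def lessThan_atLeast0 sum_distrib_left ac_simps intro!: sum.cong)

lemma frob_outer:
  assumes "A \<in> carrier_mat n n" "v \<in> carrier_vec n"
  shows "frob A (outer v) = v \<bullet> (A *\<^sub>v v)"
  unfolding form_eq_double_sum[OF assms(1,2,2)] frob_def outer_def using assms by auto

lemma smult_mat_mult_vec: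
  fixes A :: "'a :: comm_semiring_0 mat"
  assumes "A \<in> carrier_mat m n" "v \<in> carrier_vec n"
  shows "(c \<cdot>\<^sub>m A) *\<^sub>v v = c \<cdot>\<^sub>v (A *\<^sub>v v)"
  using assms by (intro eq_vecI) (auto simp: scalar_prod_def sum_distrib_left ac_simps)

lemma form_minus:
  fixes A B :: "'a :: comm_ring_1 mat"
  assumes "A \<in> carrier_mat n n" "B \<in> carrier_mat n n" "u \<in> carrier_vec n" "v \<in> carrier_vec n"
  shows "u \<bullet> ((A - B) *\<^sub>v v) = u \<bullet> (A *\<^sub>v v) - u \<bullet> (B *\<^sub>v v)"
  using assms by (simp add: minus_mult_distrib_mat_vec[of A n n] scalar_prod_minus_distrib[of _ n])

lemma symmetric_minus:
  fixes A B :: "'a :: comm_ring_1 mat"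
  assumes "A \<in> carrier_mat n n" "B \<in> carrier_mat n n" "A\<^sup>T = A" "B\<^sup>T = B"
  shows "(A - B)\<^sup>T = A - B"
  using assms by (simp add: transpose_minus)

lemma form_smult_one:
  fixes u v :: "'a :: comm_ring_1 vec"
  assumes "u \<in> carrier_vec n" "v \<in> carrier_vec n"
  shows "u \<bullet> ((c \<cdot>\<^sub>m 1\<^sub>m n) *\<^sub>v v) = c * (u \<bullet> v)"
  using assms by (simp add: smult_mat_mult_vec[of _ n n])

lemma form_add:
  fixes A B :: "'a :: comm_ring_1 mat"
  assumes "A \<in> carrier_mat n n" "B \<in> carrier_mat n n" "u \<in> carrier_vec n" "v \<in> carrier_vec n"
  shows "u \<bullet> ((A + B) *\<^sub>v v) = u \<bullet> (A *\<^sub>v v) + u \<bullet> (B *\<^sub>v v)"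
  using assms by (simp add: add_mult_distrib_mat_vec[of A n n] scalar_prod_add_distrib[of _ n])

lemma form_smult:
  fixes A :: "'a :: comm_ring_1 mat"
  assumes "A \<in> carrier_mat n n" "u \<in> carrier_vec n" "v \<in> carrier_vec n"
  shows "u \<bullet> ((c \<cdot>\<^sub>m A) *\<^sub>v v) = c * (u \<bullet> (A *\<^sub>v v))"
  using assms by (simp add: smult_mat_mult_vec[of A n n])

lemma frob_linear:
  assumes "A \<in> carrier_mat n n" "B \<in> carrier_mat n n" "X \<in> carrier_mat n n" "Y \<in> carrier_mat n n"
  shows "frob (A - B) X = frob A X - frob B X"
    "frob (c \<cdot>\<^sub>m A) X = c * frob A X" "frob A (X - Y) = frob A X - frob A Y"
    "frob (1\<^sub>m n) X = mtrace X"
proof -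
  show "frob (1\<^sub>m n) X = mtrace X"
  proof -
    have "frob (1\<^sub>m n) X = (\<Sum>r<n. \<Sum>s<n. 1\<^sub>m n $$ (r,s) * X $$ (r,s))"
      by (simp add: frob_def)
    also have "\<dots> = (\<Sum>r<n. \<Sum>s<n. if s = r then X $$ (r,r) else 0)"
      by (intro sum.cong refl) auto
    finally have "frob (1\<^sub>m n) X = (\<Sum>r<n. \<Sum>s<n. if s = r then X $$ (r,r) else 0)" .
    then show ?thesis using assms by (simp add: mtrace_def)
  qed
qed (use assms in \<open>auto simp: frob_def algebra_simps sum.distrib sum_subtractf sum_distrib_left\<close>)

lemma frob_smult_one:
  assumes "X \<in> carrier_mat n n"
  shows "frob (c \<cdot>\<^sub>m 1\<^sub>m n) X = c * mtrace X"
  using frob_linear(2,4)[of "1\<^sub>m n" n "1\<^sub>m n" X X] assms by simp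

lemma frob_msum4:
  "(\<And>i. i \<in> I \<Longrightarrow> f i \<in> carrier_mat 4 4) \<Longrightarrow> frob (msum4 I f) X = (\<Sum>i\<in>I. frob (f i) X)"
proof -
  assume f: "\<And>i. i \<in> I \<Longrightarrow> f i \<in> carrier_mat 4 4"
  have "frob (msum4 I f) X = (\<Sum>r<4. \<Sum>s<4. \<Sum>i\<in>I. f i $$ (r,s) * X $$ (r,s))"
    by (simp add: frob_def msum4_def sum_distrib_right)
  also have "\<dots> = (\<Sum>r<4. \<Sum>i\<in>I. \<Sum>s<4. f i $$ (r,s) * X $$ (r,s))"
    by (intro sum.cong refl sum.swap)
  also have "\<dots> = (\<Sum>i\<in>I. \<Sum>r<4. \<Sum>s<4. f i $$ (r,s) * X $$ (r,s))"
    by (rule sum.swap)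
  also have "\<dots> = (\<Sum>i\<in>I. frob (f i) X)"
    using f by (intro sum.cong refl) (simp add: frob_def carrier_matD[OF f])
  finally show ?thesis .
qed

lemma msum4_carrier [simp]: "msum4 I f \<in> carrier_mat 4 4"
  by (simp add: msum4_def)

lemma msum4_symmetric:
  assumes "\<And>i. i \<in> I \<Longrightarrow> f i \<in> carrier_mat 4 4" "\<And>i. i \<in> I \<Longrightarrow> (f i)\<^sup>T = f i"
  shows "(msum4 I f)\<^sup>T = msum4 I f"
proof (rule eq_matI)
  fix r s assume rs: "r < dim_row (msum4 I f)" "s < dim_col (msum4 I f)"
  then have rs: "r < 4" "s < 4" by (auto simp: msum4_def)
  have "f i $$ (s,r) = f i $$ (r,s)" if "i \<in> I" for i
    using assms that rs by (metis carrier_matD index_transpose_mat(1))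
  then show "(msum4 I f)\<^sup>T $$ (r,s) = msum4 I f $$ (r,s)" using rs by (simp add: msum4_def)
qed (auto simp: msum4_def)

lemma msum4_form:
  assumes f: "\<And>i. i \<in> I \<Longrightarrow> f i \<in> carrier_mat 4 4" and u: "u \<in> carrier_vec 4" and v: "v \<in> carrier_vec 4"
  shows "u \<bullet> (msum4 I f *\<^sub>v v) = (\<Sum>i\<in>I. u \<bullet> (f i *\<^sub>v v))"
proof -
  \<comment> \<open>A bilinear form is the trace product with a rank one matrix, so additivity of
    \<open>frob\<close> applies.\<close>
  let ?X = "mat 4 4 (\<lambda>(r,s). u $ r * v $ s)"
  have "u \<bullet> (A *\<^sub>v v) = frob A ?X" if "A \<in> carrier_mat 4 4" for A
    using that by (simp add: form_eq_double_sum[OF that u v] frob_def)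
  then show ?thesis using f by (simp add: frob_msum4)
qed

text \<open>Expanding \<open>A\<close> in its eigenvectors turns the trace product into a sum of
  terms \<open>eigs A ! i * (p i \<bullet> (X *\<^sub>v p i))\<close>, each a product of two
  nonnegative numbers.\<close>

lemma frob_nonneg:
  fixes A X :: "real mat"
  assumes A: "A \<in> carrier_mat n n" "A\<^sup>T = A" and X: "X \<in> carrier_mat n n"
    and psdA: "\<And>v. v \<in> carrier_vec n \<Longrightarrow> v \<bullet> (A *\<^sub>v v) \<ge> 0"
    and psdX: "\<And>v. v \<in> carrier_vec n \<Longrightarrow> v \<bullet> (X *\<^sub>v v) \<ge> 0"
  shows "frob A X \<ge> 0"
proof -
  obtain p where p: "\<And>i. i < n \<Longrightarrow> p i \<in> carrier_vec n"
    "\<And>i j. i < n \<Longrightarrow> j < n \<Longrightarrow> p i \<bullet> p j = (if i = j then 1 else 0)"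
    "\<And>u v. u \<in> carrier_vec n \<Longrightarrow> v \<in> carrier_vec n \<Longrightarrow>
       u \<bullet> (A *\<^sub>v v) = (\<Sum>i<n. eigs A ! i * (p i \<bullet> u) * (p i \<bullet> v))"
    by (rule spectral_theorem[OF A]) blast
  have pos: "eigs A ! k \<ge> 0" if k: "k < n" for k
  proof -
    have "p k \<bullet> (A *\<^sub>v p k) = (\<Sum>i<n. if i = k then eigs A ! k else 0)"
      unfolding p(3)[OF p(1)[OF k] p(1)[OF k]] using k by (intro sum.cong) (auto simp: p(2))
    then show ?thesis using k psdA[OF p(1)[OF k]] by simp
  qed
  have entry: "A $$ (r,s) = (\<Sum>i<n. eigs A ! i * (p i $ r * p i $ s))" if "r < n" "s < n" for r s
  proof -
    have "A $$ (r,s) = unit_vec n r \<bullet> (A *\<^sub>v unit_vec n s)"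
      using A that by (simp add: mult_mat_vec_def scalar_prod_left_unit scalar_prod_right_unit)
    also have "\<dots> = (\<Sum>i<n. eigs A ! i * (p i \<bullet> unit_vec n r) * (p i \<bullet> unit_vec n s))"
      by (rule p(3)) auto
    also have "\<dots> = (\<Sum>i<n. eigs A ! i * (p i $ r * p i $ s))"
      using p(1) that by (intro sum.cong) (auto simp: scalar_prod_right_unit)
    finally show ?thesis .
  qed
  have "frob A X = (\<Sum>r<n. \<Sum>s<n. \<Sum>i<n. eigs A ! i * (X $$ (r,s) * (p i $ r * p i $ s)))"
    using A by (simp add: frob_def entry sum_distrib_right sum_distrib_left ac_simps)
  also have "\<dots> = (\<Sum>r<n. \<Sum>i<n. \<Sum>s<n. eigs A ! i * (X $$ (r,s) * (p i $ r * p i $ s)))"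
    by (intro sum.cong refl sum.swap)
  also have "\<dots> = (\<Sum>i<n. \<Sum>r<n. \<Sum>s<n. eigs A ! i * (X $$ (r,s) * (p i $ r * p i $ s)))"
    by (rule sum.swap)
  also have "\<dots> = (\<Sum>i<n. eigs A ! i * (p i \<bullet> (X *\<^sub>v p i)))"
    using form_eq_double_sum[OF X p(1) p(1)] by (simp add: sum_distrib_left)
  also have "\<dots> \<ge> 0" using pos psdX p(1) by (intro sum_nonneg) auto
  finally show ?thesis .
qed

section \<open>Blocks of a feasible matrix\<close>

lemma blk_carrier [simp]: "blk W i j \<in> carrier_mat 4 4"
  by (simp add: blk_def)

lemma blk_index: "a < 4 \<Longrightarrow> b < 4 \<Longrightarrow> blk W i j $$ (a,b) = W $$ (4*i + a, 4*j + b)"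
  by (simp add: blk_def)

lemma sum_blocks:
  fixes f :: "nat \<Rightarrow> 'a :: comm_monoid_add"
  shows "(\<Sum>r<4*(l+1). f r) = (\<Sum>i<Suc l. \<Sum>a<4. f (4*i + a))"
proof -
  have inner: "(\<Sum>r=i*4..<i*4+4. f r) = (\<Sum>a<4. f (4*i + a))" for i
    using sum.shift_bounds_nat_ivl[of f 0 "i*4" 4] by (simp add: lessThan_atLeast0 ac_simps)
  have "(\<Sum>r<4*(l+1). f r) = (\<Sum>i<Suc l. \<Sum>r=i*4..<i*4+4. f r)"
    by (subst sum.nat_group) (simp add: mult.commute)
  then show ?thesis unfolding inner .
qed

lemma sum_block_pairs:
  fixes f :: "nat \<Rightarrow> nat \<Rightarrow> 'a :: comm_monoid_add"
  shows "(\<Sum>r<4*(l+1). \<Sum>s<4*(l+1). f r s) =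
    (\<Sum>i<Suc l. \<Sum>j<Suc l. \<Sum>a<4. \<Sum>b<4. f (4*i + a) (4*j + b))"
  unfolding sum_blocks by (intro sum.cong refl sum.swap)

text \<open>Only the blocks of \<open>bigQ\<close> in positions (0,i) and (i,0) with positive i can
  be nonzero. The symmetry of \<open>W\<close> and \<open>Q i\<close> makes the two contributions
  equal, which absorbs the factor 1/2.\<close>

lemma relax_obj_blocks:
  assumes Q: "\<And>i. i \<in> {1..l} \<Longrightarrow> Q i \<in> carrier_mat 4 4" "\<And>i. i \<in> {1..l} \<Longrightarrow> (Q i)\<^sup>T = Q i"
    and W: "W \<in> carrier_mat (4*(l+1)) (4*(l+1))" "W\<^sup>T = W"
  shows "relax_obj l Q c2 W = (\<Sum>i=1..l. frob (Q i) (blk W 0 i) + c2 i * (1 - mtrace (blk W 0 i)))"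
proof -
  let ?T = "\<lambda>i j. \<Sum>a<4. \<Sum>b<4. bigQ l Q c2 $$ (4*i + a, 4*j + b) * W $$ (4*j + b, 4*i + a)"
  have symW: "W $$ (s,r) = W $$ (r,s)" if "r < 4*(l+1)" "s < 4*(l+1)" for r s
    using W that by (metis carrier_matD index_transpose_mat(1))
  have div: "(4*i + a) div 4 = i" "(4*i + a) mod 4 = a" if "a < 4" for i a :: nat
    using that by auto
  let ?D = "\<lambda>i. Q i - c2 i \<cdot>\<^sub>m 1\<^sub>m 4"
  have D: "?D i \<in> carrier_mat 4 4" "?D i $$ (b,a) = ?D i $$ (a,b)" if "i \<in> {1..l}" "a < 4" "b < 4" for i a b
  proof -
    have "Q i $$ (b,a) = Q i $$ (a,b)" using Q that by (metis carrier_matD index_transpose_mat(1))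
    then show "?D i \<in> carrier_mat 4 4" "?D i $$ (b,a) = ?D i $$ (a,b)" using Q(1)[OF that(1)] that by auto
  qed
  have T0: "?T 0 i = 1/2 * frob (?D i) (blk W 0 i)" if i: "i \<in> {1..l}" for i
  proof -
    have "?T 0 i = (\<Sum>a<4. \<Sum>b<4. 1/2 * (?D i $$ (a,b) * blk W 0 i $$ (a,b)))"
    proof (intro sum.cong refl)
      fix a b :: nat assume "a \<in> {..<4}" "b \<in> {..<4}"
      then have ab: "a < 4" "b < 4" by auto
      have lt: "a < 4*(l+1)" "4*i + b < 4*(l+1)" using ab i by auto
      show "bigQ l Q c2 $$ (4*0 + a, 4*i + b) * W $$ (4*i + b, 4*0 + a) = 1/2 * (?D i $$ (a,b) * blk W 0 i $$ (a,b))"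
        using ab i lt D(1)[OF i ab] symW[OF lt] div[OF ab(2), of i] by (simp add: bigQ_def blk_def)
    qed
    then show ?thesis using D(1)[OF i, of 0 0] by (simp add: frob_def sum_distrib_left)
  qed
  have T1: "?T i 0 = 1/2 * frob (?D i) (blk W 0 i)" if i: "i \<in> {1..l}" for i
  proof -
    have "?T i 0 = (\<Sum>a<4. \<Sum>b<4. 1/2 * (?D i $$ (b,a) * blk W 0 i $$ (b,a)))"
    proof (intro sum.cong refl)
      fix a b :: nat assume "a \<in> {..<4}" "b \<in> {..<4}"
      then have ab: "a < 4" "b < 4" by auto
      have lt: "b < 4*(l+1)" "4*i + a < 4*(l+1)" using ab i by auto
      show "bigQ l Q c2 $$ (4*i + a, 4*0 + b) * W $$ (4*0 + b, 4*i + a) = 1/2 * (?D i $$ (b,a) * blk W 0 i $$ (b,a))"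
        using ab i lt D(1)[OF i ab] D(2)[OF i ab] div[OF ab(1), of i] by (simp add: bigQ_def blk_def)
    qed
    also have "\<dots> = (\<Sum>b<4. \<Sum>a<4. 1/2 * (?D i $$ (b,a) * blk W 0 i $$ (b,a)))"
      by (rule sum.swap)
    finally show ?thesis using D(1)[OF i, of 0 0] by (simp add: frob_def sum_distrib_left)
  qed
  \<comment> \<open>Covers the corner block and every block with both indices positive.\<close>
  have T2: "?T i j = 0" if "i = 0 \<longleftrightarrow> j = 0" "i \<le> l" "j \<le> l" for i j
  proof (intro sum.neutral ballI)
    fix a b :: nat assume "a \<in> {..<4}" "b \<in> {..<4}"
    then have ab: "a < 4" "b < 4" by auto
    have "4*i + a < 4*(l+1)" "4*j + b < 4*(l+1)" using ab that by auto
    then show "bigQ l Q c2 $$ (4*i + a, 4*j + b) * W $$ (4*j + b, 4*i + a) = 0"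
      using that div[OF ab(1), of i] div[OF ab(2), of j] by (auto simp: bigQ_def)
  qed
  have "mtrace (bigQ l Q c2 * W) = (\<Sum>r<4*(l+1). \<Sum>s<4*(l+1). bigQ l Q c2 $$ (r,s) * W $$ (s,r))"
    unfolding mtrace_def using W by (auto simp: bigQ_def scalar_prod_def lessThan_atLeast0 intro!: sum.cong)
  also have "\<dots> = (\<Sum>i<Suc l. \<Sum>j<Suc l. ?T i j)" by (rule sum_block_pairs)
  also have "\<dots> = ?T 0 0 + (\<Sum>j=1..l. ?T 0 j) + (\<Sum>i=1..l. ?T i 0 + (\<Sum>j=1..l. ?T i j))"
  proof -
    have split: "(\<Sum>i<Suc l. g i) = g 0 + (\<Sum>i=1..l. g i)" for g :: "nat \<Rightarrow> real"
      by (simp only: lessThan_Suc_atMost atMost_atLeast0) (simp add: sum.atLeast_Suc_atMost)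
    show ?thesis unfolding split ..
  qed
  also have "\<dots> = (\<Sum>i=1..l. frob (?D i) (blk W 0 i))"
  proof -
    have "?T 0 0 = 0" by (rule T2) auto
    moreover have "(\<Sum>j=1..l. ?T 0 j) = (\<Sum>j=1..l. 1/2 * frob (?D j) (blk W 0 j))"
      using T0 by (intro sum.cong refl)
    moreover have "(\<Sum>i=1..l. ?T i 0 + (\<Sum>j=1..l. ?T i j)) = (\<Sum>j=1..l. 1/2 * frob (?D j) (blk W 0 j))"
    proof (intro sum.cong refl)
      fix i assume i: "i \<in> {1..l}"
      have "(\<Sum>j=1..l. ?T i j) = 0" using i by (intro sum.neutral ballI T2) auto
      then show "?T i 0 + (\<Sum>j=1..l. ?T i j) = 1/2 * frob (?D i) (blk W 0 i)" using T1[OF i] by simp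
    qed
    ultimately show ?thesis by (simp flip: sum_divide_distrib)
  qed
  also have "\<dots> = (\<Sum>i=1..l. frob (Q i) (blk W 0 i) - c2 i * mtrace (blk W 0 i))"
    by (intro sum.cong refl) (simp add: frob_smult_one[OF blk_carrier]
      frob_linear(1)[OF Q(1) smult_carrier_mat[OF one_carrier_mat] blk_carrier blk_carrier])
  finally show ?thesis by (simp add: relax_obj_def sum.distrib algebra_simps sum_subtractf)
qed

text \<open>The test vector has \<open>t i\<close> times \<open>v\<close> as its i-th block. For
  fixed \<open>v\<close>, semidefiniteness of \<open>W\<close> thus passes to the matrix of the
  numbers \<open>v \<bullet> (blk W i j *\<^sub>v v)\<close>, with \<open>t\<close> as the free
  vector.\<close>

lemma block_scaled_form:
  fixes t :: "nat \<Rightarrow> real"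
  assumes W: "W \<in> carrier_mat (4*(l+1)) (4*(l+1))" and v: "v \<in> carrier_vec 4"
  defines "V \<equiv> vec (4*(l+1)) (\<lambda>r. t (r div 4) * v $ (r mod 4))"
  shows "V \<bullet> (W *\<^sub>v V) = (\<Sum>i<Suc l. \<Sum>j<Suc l. t i * t j * (v \<bullet> (blk W i j *\<^sub>v v)))"
proof -
  have V: "V \<in> carrier_vec (4*(l+1))" by (simp add: V_def)
  have Vi: "V $ (4*i + a) = t i * v $ a" if "a < 4" "i < Suc l" for i a using that by (simp add: V_def)
  have "V \<bullet> (W *\<^sub>v V) = (\<Sum>i<Suc l. \<Sum>j<Suc l. \<Sum>a<4. \<Sum>b<4. W $$ (4*i + a, 4*j + b) * (V $ (4*i + a) * V $ (4*j + b)))"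
    unfolding form_eq_double_sum[OF W V V] by (rule sum_block_pairs)
  also have "\<dots> = (\<Sum>i<Suc l. \<Sum>j<Suc l. t i * t j * (v \<bullet> (blk W i j *\<^sub>v v)))"
    unfolding form_eq_double_sum[OF blk_carrier v v] sum_distrib_left
    by (intro sum.cong refl) (simp add: Vi blk_index)
  finally show ?thesis .
qed

text \<open>Coefficients supported at one index give the diagonal blocks. The difference of the
  indicators of 0 and \<open>i\<close> gives the form of
  \<open>[W]_00 - [W]_0i - [W]_i0 + [W]_ii\<close>, which symmetry and the constraint
  \<open>[W]_0i = [W]_ii\<close> collapse to that of \<open>[W]_00 - [W]_0i\<close>.\<close>

lemma sdr_block_bounds:
  assumes W: "sdr_feasible l W" and i: "i \<in> {1..l}" and v: "v \<in> carrier_vec 4"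
  shows "v \<bullet> (blk W 0 0 *\<^sub>v v) \<ge> 0" "v \<bullet> (blk W 0 i *\<^sub>v v) \<ge> 0"
    "v \<bullet> ((blk W 0 0 - blk W 0 i) *\<^sub>v v) \<ge> 0"
proof -
  have Wc: "W \<in> carrier_mat (4*(l+1)) (4*(l+1))" and ps: "psd W" and cs: "relax_constr l W"
    using W by (auto simp: sdr_feasible_def)
  let ?B = "\<lambda>i j. v \<bullet> (blk W i j *\<^sub>v v)"
  have pos: "(\<Sum>i<Suc l. \<Sum>j<Suc l. t i * t j * ?B i j) \<ge> 0" for t :: "nat \<Rightarrow> real"
    using ps Wc by (subst block_scaled_form[OF Wc v, symmetric]) (simp add: psd_def)
  have single: "?B k k \<ge> 0" if "k < Suc l" for k
  proof -
    let ?t = "\<lambda>j. if j = k then 1 else 0 :: real"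
    have "(\<Sum>i<Suc l. \<Sum>j<Suc l. ?t i * ?t j * ?B i j) = (\<Sum>i<Suc l. \<Sum>j<Suc l. if j = k then (if i = k then ?B k k else 0) else 0)"
      by (intro sum.cong) auto
    also have "\<dots> = ?B k k" using that by (simp only: sum.delta finite_lessThan) simp
    finally show ?thesis using pos[of ?t] by simp
  qed
  have eq: "blk W i i = blk W 0 i" using cs i by (simp add: relax_constr_def)
  have sym: "?B i 0 = ?B 0 i"
  proof -
    have "blk W i 0 $$ (a,b) = blk W 0 i $$ (b,a)" if "a < 4" "b < 4" for a b
    proof -
      have "W\<^sup>T = W" using ps by (simp add: psd_def)
      moreover have "4*i + a < 4*(l+1)" "b < 4*(l+1)" using that i by auto
      ultimately have "W $$ (4*i + a, b) = W $$ (b, 4*i + a)" using Wc by (metis carrier_matD index_transpose_mat(1))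
      then show ?thesis using that by (simp add: blk_def)
    qed
    then show ?thesis
      unfolding form_eq_double_sum[OF blk_carrier v v] by (subst sum.swap) (simp add: ac_simps)
  qed
  show "?B 0 0 \<ge> 0" using single by simp
  show "?B 0 i \<ge> 0" using single[of i] i eq by simp
  let ?t = "\<lambda>j. (if j = 0 then 1 else 0) - (if j = i then 1 else 0 :: real)"
  have row: "(\<Sum>j<Suc l. ?t j * g j) = g 0 - g i" for g :: "nat \<Rightarrow> real"
  proof -
    have "(\<Sum>j<Suc l. ?t j * g j) = (\<Sum>j<Suc l. (if j = 0 then g 0 else 0) - (if j = i then g i else 0))"
      by (intro sum.cong) auto
    also have "\<dots> = g 0 - g i" unfolding sum_subtractf using i by (simp add: sum.delta del: sum.lessThan_Suc)
    finally show ?thesis .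
  qed
  have "(\<Sum>k<Suc l. \<Sum>j<Suc l. ?t k * ?t j * ?B k j) = (\<Sum>k<Suc l. ?t k * (\<Sum>j<Suc l. ?t j * ?B k j))"
    by (simp only: sum_distrib_left mult.assoc)
  also have "\<dots> = (?B 0 0 - ?B 0 i) - (?B i 0 - ?B i i)" unfolding row ..
  also have "\<dots> = ?B 0 0 - ?B 0 i" using sym eq by simp
  finally have "?B 0 0 - ?B 0 i \<ge> 0" using pos[of ?t] by simp
  then show "v \<bullet> ((blk W 0 0 - blk W 0 i) *\<^sub>v v) \<ge> 0"
    unfolding form_minus[OF blk_carrier blk_carrier v v] .
qed

text \<open>Weak duality: \<open>G i\<close>, \<open>C i\<close> and \<open>M\<close> act as
  multipliers, each paired with a positive semidefinite block expression of \<open>W\<close>. The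
  three hypotheses on forms are exactly the semidefiniteness of these multipliers.\<close>

lemma sdr_lower_bound:
  assumes Q: "\<And>i. i \<in> {1..l} \<Longrightarrow> Q i \<in> carrier_mat 4 4" "\<And>i. i \<in> {1..l} \<Longrightarrow> (Q i)\<^sup>T = Q i"
    and G: "\<And>i. i \<in> {1..l} \<Longrightarrow> G i \<in> carrier_mat 4 4" "\<And>i. i \<in> {1..l} \<Longrightarrow> (G i)\<^sup>T = G i"
    and Gpos: "\<And>i v. i \<in> {1..l} \<Longrightarrow> v \<in> carrier_vec 4 \<Longrightarrow> v \<bullet> (G i *\<^sub>v v) \<ge> 0"
    and c: "\<And>i v. i \<in> {1..l} \<Longrightarrow> v \<in> carrier_vec 4 \<Longrightarrow>
      v \<bullet> (Q i *\<^sub>v v) - v \<bullet> (G i *\<^sub>v v) \<le> c2 i * (v \<bullet> v)"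
    and mu: "\<And>v. v \<in> carrier_vec 4 \<Longrightarrow>
      mu * (v \<bullet> v) \<le> (\<Sum>i=1..l. v \<bullet> (Q i *\<^sub>v v) - v \<bullet> (G i *\<^sub>v v))"
    and l: "l \<ge> 1" and W: "sdr_feasible l W"
  shows "mu \<le> relax_obj l Q c2 W"
proof -
  have Wc: "W \<in> carrier_mat (4*(l+1)) (4*(l+1))" and ps: "psd W" and cs: "relax_constr l W"
    using W by (auto simp: sdr_feasible_def)
  let ?X = "\<lambda>i. blk W 0 i"
  note X = blk_carrier[of W 0]
  have tr: "mtrace (?X 0) = 1" using cs by (simp add: relax_constr_def)
  have symI: "(s \<cdot>\<^sub>m 1\<^sub>m 4 :: real mat)\<^sup>T = s \<cdot>\<^sub>m 1\<^sub>m 4" for s by (rule eq_matI) auto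
  let ?I = "\<lambda>s :: real. s \<cdot>\<^sub>m 1\<^sub>m 4"
  have I: "?I s \<in> carrier_mat 4 4" for s by simp
  define C where "C i = ?I (c2 i) - (Q i - G i)" for i
  define M where "M = msum4 {1..l} (\<lambda>i. Q i - G i) - ?I mu"
  have QG: "Q i - G i \<in> carrier_mat 4 4" "(Q i - G i)\<^sup>T = Q i - G i" if "i \<in> {1..l}" for i
    using that by (auto intro!: minus_carrier_mat symmetric_minus[of _ 4] Q G)
  have 1: "frob (G i) (?X i) \<ge> 0" if i: "i \<in> {1..l}" for i
    by (rule frob_nonneg[OF G(1,2)[OF i] X Gpos[OF i] sdr_block_bounds(2)[OF W i]])
  have 2: "frob (C i) (?X 0 - ?X i) \<ge> 0" if i: "i \<in> {1..l}" for i
  proof (rule frob_nonneg[OF _ _ _ _ sdr_block_bounds(3)[OF W i]])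
    show "C i \<in> carrier_mat 4 4" "(C i)\<^sup>T = C i" unfolding C_def
      by (intro minus_carrier_mat symmetric_minus[of _ 4] QG[OF i] I symI)+
    show "?X 0 - ?X i \<in> carrier_mat 4 4" by (intro minus_carrier_mat) simp
    show "v \<bullet> (C i *\<^sub>v v) \<ge> 0" if "v \<in> carrier_vec 4" for v
      using form_minus[OF I QG(1)[OF i] that that] form_minus[OF Q(1)[OF i] G(1)[OF i] that that] form_smult_one[OF that that] c[OF i that]
      by (simp add: C_def)
  qed simp_all
  have 3: "frob M (?X 0) \<ge> 0"
  proof (rule frob_nonneg[OF _ _ X])
    show "M \<in> carrier_mat 4 4" by (simp add: M_def minus_carrier_mat)
    show "M\<^sup>T = M" unfolding M_def
      by (rule symmetric_minus[OF msum4_carrier I msum4_symmetric symI]) (use QG in auto)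
    show "v \<bullet> (M *\<^sub>v v) \<ge> 0" if v: "v \<in> carrier_vec 4" for v
    proof -
      have "v \<bullet> (msum4 {1..l} (\<lambda>i. Q i - G i) *\<^sub>v v) = (\<Sum>i=1..l. v \<bullet> ((Q i - G i) *\<^sub>v v))"
        by (rule msum4_form) (use QG v in auto)
      also have "\<dots> = (\<Sum>i=1..l. v \<bullet> (Q i *\<^sub>v v) - v \<bullet> (G i *\<^sub>v v))"
        by (intro sum.cong refl form_minus[OF Q(1) G(1) v v])
      finally show ?thesis
        unfolding M_def form_minus[OF msum4_carrier I v v] form_smult_one[OF v v] using mu[OF v] by simp
    qed
    show "v \<bullet> (?X 0 *\<^sub>v v) \<ge> 0" if v: "v \<in> carrier_vec 4" for v
      using sdr_block_bounds(1)[OF W _ v, of 1] l by simp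
  qed
  have "frob (msum4 {1..l} (\<lambda>i. Q i - G i)) (?X 0) = (\<Sum>i=1..l. frob (Q i - G i) (?X 0))"
    by (rule frob_msum4) (use QG in auto)
  also have "\<dots> = (\<Sum>i=1..l. frob (Q i) (?X 0) - frob (G i) (?X 0))"
    by (intro sum.cong refl frob_linear(1)[OF Q(1) G(1) X X])
  \<comment> \<open>The trace constraint on the corner block enters here: it turns the shift by
    \<open>mu\<close> times the identity into the number \<open>mu\<close>.\<close>
  finally have "frob M (?X 0) = (\<Sum>i=1..l. frob (Q i) (?X 0) - frob (G i) (?X 0)) - mu"
    unfolding M_def frob_linear(1)[OF msum4_carrier I X X] by (simp add: frob_smult_one[OF X] tr)
  moreover have "(\<Sum>i=1..l. frob (C i) (?X 0 - ?X i)) = (\<Sum>i=1..l. frob (Q i) (?X i) + c2 i * (1 - mtrace (?X i))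
      - frob (G i) (?X i) - (frob (Q i) (?X 0) - frob (G i) (?X 0)))"
  proof (intro sum.cong refl)
    fix i assume i: "i \<in> {1..l}"
    have C: "C i \<in> carrier_mat 4 4" unfolding C_def using QG(1)[OF i] by (rule minus_carrier_mat)
    have e: "frob (C i) (?X j) = c2 i * mtrace (?X j) - (frob (Q i) (?X j) - frob (G i) (?X j))" for j
      unfolding C_def using frob_linear(1)[OF I QG(1)[OF i] X X] frob_linear(1)[OF Q(1)[OF i] G(1)[OF i] X X] frob_smult_one[OF X]
      by simp
    show "frob (C i) (?X 0 - ?X i) = frob (Q i) (?X i) + c2 i * (1 - mtrace (?X i))
      - frob (G i) (?X i) - (frob (Q i) (?X 0) - frob (G i) (?X 0))"
      using frob_linear(3)[OF C C X X] by (simp add: e tr algebra_simps)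
  qed
  moreover have "relax_obj l Q c2 W = (\<Sum>i=1..l. frob (Q i) (?X i) + c2 i * (1 - mtrace (?X i)))"
    by (rule relax_obj_blocks[OF Q Wc]) (use ps in \<open>auto simp: psd_def\<close>)
  \<comment> \<open>The terms in the corner block contributed by \<open>C i\<close> and
    \<open>M\<close> cancel, and so do those pairing \<open>G i\<close> with
    \<open>?X i\<close>.\<close>
  ultimately have "relax_obj l Q c2 W - mu = (\<Sum>i=1..l. frob (G i) (?X i) + frob (C i) (?X 0 - ?X i)) + frob M (?X 0)"
    by (simp add: sum.distrib sum_subtractf)
  also have "\<dots> \<ge> 0" using 1 2 3 by (intro add_nonneg_nonneg sum_nonneg) auto
  finally show ?thesis by simp
qed

section \<open>Rank one feasible points and tightness\<close>

lemma outer_psd: "psd (outer v)"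
proof -
  have "u \<bullet> (outer v *\<^sub>v u) = (v \<bullet> u)\<^sup>2" if "u \<in> carrier_vec (dim_vec v)" for u
  proof -
    have "outer v \<in> carrier_mat (dim_vec v) (dim_vec v)" by (simp add: outer_def)
    then have "u \<bullet> (outer v *\<^sub>v u) = (\<Sum>r<dim_vec v. \<Sum>s<dim_vec v. (v $ r * u $ r) * (v $ s * u $ s))"
      unfolding form_eq_double_sum[OF \<open>outer v \<in> _\<close> that that]
      by (intro sum.cong refl) (simp add: outer_def)
    also have "\<dots> = (v \<bullet> u)\<^sup>2"
      using carrier_vecD[OF that] unfolding sum_product[symmetric] by (simp add: scalar_prod_def lessThan_atLeast0 power2_eq_square)
    finally show ?thesis .
  qed
  moreover have "(outer v)\<^sup>T = outer v" by (rule eq_matI) (auto simp: outer_def)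
  moreover have "dim_row (outer v) = dim_vec v" by (simp add: outer_def)
  moreover have "outer v \<in> carrier_mat (dim_vec v) (dim_vec v)" by (simp add: outer_def)
  ultimately show ?thesis unfolding psd_def by (metis carrier_vecI zero_le_power2)
qed

lemma qcqp_feasible_imp_sdr: "qcqp_feasible l v \<Longrightarrow> sdr_feasible l (outer v)"
  unfolding qcqp_feasible_def sdr_feasible_def using outer_psd[of v] by (auto simp: outer_def)

lemma blk_outer_stack:
  assumes "w \<in> carrier_vec 4" "i \<le> l" "j \<le> l"
  shows "blk (outer (stack l w)) i j = outer w"
proof (rule eq_matI)
  fix a b assume "a < dim_row (outer w)" "b < dim_col (outer w)"
  then have ab: "a < 4" "b < 4" using assms by (auto simp: outer_def)
  moreover have "4*i + a < 4*(l+1)" "4*j + b < 4*(l+1)" using ab assms by auto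
  ultimately show "blk (outer (stack l w)) i j $$ (a,b) = outer w $$ (a,b)"
    using assms by (simp add: blk_def outer_def stack_def)
qed (use assms in \<open>auto simp: blk_def outer_def\<close>)

lemma mtrace_outer: "mtrace (outer w) = w \<bullet> w"
  by (simp add: mtrace_def outer_def scalar_prod_def lessThan_atLeast0)

lemma stack_feasible:
  assumes "w \<in> carrier_vec 4" "w \<bullet> w = 1"
  shows "qcqp_feasible l (stack l w)"
  using assms by (auto simp: qcqp_feasible_def relax_constr_def blk_outer_stack mtrace_outer) (simp add: stack_def)

text \<open>Each block is \<open>outer w\<close> with trace 1, so the terms weighted by
  \<open>c2 i\<close> vanish and the untruncated objective remains.\<close>

lemma relax_obj_stack:
  assumes Q: "\<And>i. i \<in> {1..l} \<Longrightarrow> Q i \<in> carrier_mat 4 4" "\<And>i. i \<in> {1..l} \<Longrightarrow> (Q i)\<^sup>T = Q i"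
    and w: "w \<in> carrier_vec 4" "w \<bullet> w = 1"
  shows "relax_obj l Q c2 (outer (stack l w)) = (\<Sum>i=1..l. w \<bullet> (Q i *\<^sub>v w))"
proof -
  have c: "outer (stack l w) \<in> carrier_mat (4*(l+1)) (4*(l+1))" by (simp add: outer_def stack_def)
  have s: "(outer (stack l w))\<^sup>T = outer (stack l w)" using outer_psd by (simp add: psd_def)
  have "relax_obj l Q c2 (outer (stack l w)) = (\<Sum>i=1..l. frob (Q i) (blk (outer (stack l w)) 0 i)
      + c2 i * (1 - mtrace (blk (outer (stack l w)) 0 i)))"
    by (rule relax_obj_blocks[OF _ _ c s]) (use Q in auto)
  also have "\<dots> = (\<Sum>i=1..l. w \<bullet> (Q i *\<^sub>v w))"
    by (intro sum.cong refl) (use w Q in \<open>simp add: blk_outer_stack mtrace_outer frob_outer[of _ 4]\<close>)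
  finally show ?thesis .
qed

text \<open>Lifting a feasible vector gives a feasible matrix, so one lower bound over matrices
  yields minimality in both problems.\<close>

lemma sdr_tight_atI:
  assumes "qcqp_feasible l v" and "\<And>W. sdr_feasible l W \<Longrightarrow> relax_obj l Q c2 (outer v) \<le> relax_obj l Q c2 W"
  shows "sdr_tight_at l Q c2 v"
  using assms by (simp add: sdr_tight_at_def qcqp_global_min_def sdr_global_min_def qcqp_feasible_imp_sdr)

subsection \<open>Dual certificate and angle bound\<close>

lemma vnorm_nonneg [simp]: "vnorm v \<ge> 0"
  unfolding vnorm_def by (simp add: scalar_prod_def sum_nonneg)

lemma scalar_prod_Cauchy_Schwarz:
  fixes u w :: "real vec"
  assumes u: "u \<in> carrier_vec n" and w: "w \<in> carrier_vec n"
  shows "\<bar>u \<bullet> w\<bar> \<le> vnorm u * vnorm w"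
proof (cases "w = 0\<^sub>v n")
  case True
  then show ?thesis using u by (simp add: vnorm_def)
next
  case False
  have pos: "w \<bullet> w > 0" using conjugate_square_greater_0_vec[OF w] False by (metis conjugate_real_vec)
  define z where "z = u - ((u \<bullet> w) / (w \<bullet> w)) \<cdot>\<^sub>v w"
  have "0 \<le> z \<bullet> z" by (simp add: scalar_prod_def sum_nonneg)
  also have "z \<bullet> z = u \<bullet> u - 2 * ((u \<bullet> w) / (w \<bullet> w)) * (u \<bullet> w) + ((u \<bullet> w) / (w \<bullet> w))\<^sup>2 * (w \<bullet> w)"
    unfolding z_def using u w comm_scalar_prod[OF w u]
    by (simp add: minus_scalar_prod_distrib[of _ n] scalar_prod_minus_distrib[of _ n] power2_eq_square algebra_simps)
  also have "\<dots> = u \<bullet> u - (u \<bullet> w)\<^sup>2 / (w \<bullet> w)"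
    using pos by (simp add: power2_eq_square)
  finally have "(u \<bullet> w)\<^sup>2 \<le> (u \<bullet> u) * (w \<bullet> w)" using pos by (simp add: pos_divide_le_eq)
  then have "(u \<bullet> w)\<^sup>2 \<le> (vnorm u * vnorm w)\<^sup>2" by (simp add: power_mult_distrib sq_vnorm)
  then show ?thesis by (simp add: abs_le_square_iff[symmetric] abs_mult)
qed

lemma form_expand:
  fixes A :: "real mat"
  assumes A: "A \<in> carrier_mat n n" "A\<^sup>T = A" and h: "h \<in> carrier_vec n" and u: "u \<in> carrier_vec n"
  shows "(a \<cdot>\<^sub>v h + u) \<bullet> (A *\<^sub>v (a \<cdot>\<^sub>v h + u)) = a\<^sup>2 * (h \<bullet> (A *\<^sub>v h)) + 2 * a * (h \<bullet> (A *\<^sub>v u)) + u \<bullet> (A *\<^sub>v u)"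
proof -
  have Ah: "A *\<^sub>v h \<in> carrier_vec n" and Au: "A *\<^sub>v u \<in> carrier_vec n" using A h u by simp_all
  have "A *\<^sub>v (a \<cdot>\<^sub>v h + u) = a \<cdot>\<^sub>v (A *\<^sub>v h) + A *\<^sub>v u"
    using A h u by (simp add: mult_add_distrib_mat_vec[of A n n] mult_mat_vec[of A n n])
  then show ?thesis
    using h u Ah Au symmetric_form_commute[OF A h u]
    by (simp add: add_scalar_prod_distrib[of _ n] scalar_prod_add_distrib[of _ n] power2_eq_square algebra_simps)
qed

lemma orthogonal_split:
  fixes h v :: "real vec"
  assumes h: "h \<in> carrier_vec n" "h \<bullet> h = 1" and v: "v \<in> carrier_vec n"
  defines "u \<equiv> v - (h \<bullet> v) \<cdot>\<^sub>v h"
  shows "u \<in> carrier_vec n" "h \<bullet> u = 0" "v = (h \<bullet> v) \<cdot>\<^sub>v h + u" "v \<bullet> v = (h \<bullet> v)\<^sup>2 + u \<bullet> u"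
proof -
  show u: "u \<in> carrier_vec n" unfolding u_def using h v by simp
  show hu: "h \<bullet> u = 0" unfolding u_def using h v by (simp add: scalar_prod_minus_distrib[of _ n])
  show "v = (h \<bullet> v) \<cdot>\<^sub>v h + u" unfolding u_def using h v by (intro eq_vecI) auto
  show "v \<bullet> v = (h \<bullet> v)\<^sup>2 + u \<bullet> u" unfolding u_def using h v comm_scalar_prod[OF h(1) v]
    by (simp add: minus_scalar_prod_distrib[of _ n] scalar_prod_minus_distrib[of _ n] power2_eq_square algebra_simps)
qed

text \<open>For unit \<open>h\<close> the outer factors are the orthogonal projection onto the
  complement of \<open>h\<close>, so the compressed form ignores the component along
  \<open>h\<close>.\<close>

definition orth_compress :: "nat \<Rightarrow> real vec \<Rightarrow> real mat \<Rightarrow> real mat" where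
  "orth_compress n h H = (1\<^sub>m n - outer h) * (H * (1\<^sub>m n - outer h))"

lemma orth_compress:
  assumes H: "H \<in> carrier_mat n n" "H\<^sup>T = H" and h: "h \<in> carrier_vec n"
  shows "orth_compress n h H \<in> carrier_mat n n" "(orth_compress n h H)\<^sup>T = orth_compress n h H"
    "v \<in> carrier_vec n \<Longrightarrow> v \<bullet> (orth_compress n h H *\<^sub>v v)
      = (v - (h \<bullet> v) \<cdot>\<^sub>v h) \<bullet> (H *\<^sub>v (v - (h \<bullet> v) \<cdot>\<^sub>v h))"
proof -
  let ?P = "1\<^sub>m n - outer h"
  have o: "outer h \<in> carrier_mat n n" using h by (simp add: outer_def)
  have P: "?P \<in> carrier_mat n n" using o by (rule minus_carrier_mat)
  have symP: "?P\<^sup>T = ?P" using h by (intro eq_matI) (auto simp: outer_def)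
  have Pv: "?P *\<^sub>v v = v - (h \<bullet> v) \<cdot>\<^sub>v h" if v: "v \<in> carrier_vec n" for v
  proof -
    have "outer h *\<^sub>v v = (h \<bullet> v) \<cdot>\<^sub>v h"
    proof (rule eq_vecI)
      fix r assume "r < dim_vec ((h \<bullet> v) \<cdot>\<^sub>v h)"
      then have "(outer h *\<^sub>v v) $ r = (\<Sum>s = 0..<n. h $ r * (h $ s * v $ s))"
        using h v by (simp add: outer_def scalar_prod_def mult.assoc)
      also have "\<dots> = h $ r * (h \<bullet> v)" using v by (simp add: scalar_prod_def sum_distrib_left)
      finally show "(outer h *\<^sub>v v) $ r = ((h \<bullet> v) \<cdot>\<^sub>v h) $ r"
        using \<open>r < _\<close> by simp
    qed (use h in \<open>simp add: outer_def\<close>)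
    then show ?thesis using o v by (simp add: minus_mult_distrib_mat_vec[of _ n n])
  qed
  show "orth_compress n h H \<in> carrier_mat n n" unfolding orth_compress_def using P H by simp
  show "(orth_compress n h H)\<^sup>T = orth_compress n h H"
    unfolding orth_compress_def using P H
    by (simp add: transpose_mult[of _ n n _ n] symP assoc_mult_mat[of _ n n _ n _ n])
  assume v: "v \<in> carrier_vec n"
  have 1: "orth_compress n h H *\<^sub>v v = ?P *\<^sub>v (H *\<^sub>v (?P *\<^sub>v v))"
    unfolding orth_compress_def using P H v by (simp add: assoc_mult_mat_vec[of _ n n _ n])
  have 2: "v \<bullet> (?P *\<^sub>v w) = (?P *\<^sub>v v) \<bullet> w" if "w \<in> carrier_vec n" for w
    using transpose_vec_mult_scalar[OF P that v] symP by simp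
  have w: "H *\<^sub>v (?P *\<^sub>v v) \<in> carrier_vec n" using P H v by simp
  show "v \<bullet> (orth_compress n h H *\<^sub>v v)
      = (v - (h \<bullet> v) \<cdot>\<^sub>v h) \<bullet> (H *\<^sub>v (v - (h \<bullet> v) \<cdot>\<^sub>v h))"
    unfolding 1 2[OF w] unfolding Pv[OF v] ..
qed

text \<open>Separates tightness from the quaternion setting: it works with symmetric positive
  semidefinite \<open>Q i\<close> and a unit vector \<open>h\<close> minimising the form of their
  sum.\<close>

lemma sdr_tight_at_stack:
  fixes l :: nat and Q :: "nat \<Rightarrow> real mat" and c2 :: "nat \<Rightarrow> real" and h :: "real vec"
  defines "S \<equiv> msum4 {1..l} Q"
  defines "zeta \<equiv> lambda_min2 S / lambda_min S"
  defines "d \<equiv> (\<lambda>i. (\<Sum>k=1..l. h \<bullet> (Q k *\<^sub>v h)) / real l - h \<bullet> (Q i *\<^sub>v h)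
                 + lambda_max (msum4 ({1..l} - {i}) (\<lambda>j. Q i - Q j)) / (zeta * (real l - 1)))"
  assumes l: "l \<ge> 2"
    and Q: "\<And>i. i \<in> {1..l} \<Longrightarrow> Q i \<in> carrier_mat 4 4" "\<And>i. i \<in> {1..l} \<Longrightarrow> (Q i)\<^sup>T = Q i"
    and Qpos: "\<And>i v. i \<in> {1..l} \<Longrightarrow> v \<in> carrier_vec 4 \<Longrightarrow> v \<bullet> (Q i *\<^sub>v v) \<ge> 0"
    and h: "h \<in> carrier_vec 4" "h \<bullet> h = 1"
    and hmin: "h \<bullet> (S *\<^sub>v h) = lambda_min S"
    and zeta: "zeta \<ge> real l / (real l - 1)"
    and c: "\<And>i. i \<in> {1..l} \<Longrightarrow> c2 i > h \<bullet> (Q i *\<^sub>v h) + vnorm (Q i *\<^sub>v h) + (\<bar>d i\<bar> + d i) / 2"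
  shows "sdr_tight_at l Q c2 (stack l h)"
proof -
  define mu where "mu = lambda_min S"
  define t where "t = real l / (zeta * (real l - 1))"
  have l1: "real l - 1 > 0" "real l > 0" using l by auto
  have S: "S \<in> carrier_mat 4 4" "S\<^sup>T = S"
    unfolding S_def by (simp, rule msum4_symmetric) (use Q in auto)
  have Sform: "u \<bullet> (S *\<^sub>v v) = (\<Sum>i=1..l. u \<bullet> (Q i *\<^sub>v v))" if "u \<in> carrier_vec 4" "v \<in> carrier_vec 4" for u v
    unfolding S_def by (rule msum4_form) (use Q that in auto)
  have zpos: "zeta > 0" using zeta l1 by (meson divide_pos_pos less_le_trans)
  have mu_eq: "mu = (\<Sum>i=1..l. h \<bullet> (Q i *\<^sub>v h))" unfolding mu_def hmin[symmetric] by (rule Sform[OF h(1) h(1)])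
  have "mu \<ge> 0" unfolding mu_eq using Qpos h(1) by (intro sum_nonneg) auto
  \<comment> \<open>Division by zero yields 0, so a vanishing \<open>mu\<close> would make
    \<open>zeta\<close> zero.\<close>
  moreover have "mu \<noteq> 0" using zpos unfolding zeta_def mu_def by auto
  ultimately have mupos: "mu > 0" by simp
  have lam2: "lambda_min2 S = zeta * mu" unfolding zeta_def using mupos by (simp add: mu_def)
  have tpos: "t > 0" unfolding t_def using zpos l1 by simp
  have t1: "t \<le> 1" unfolding t_def using zeta zpos l1 by (simp add: field_simps)
  \<comment> \<open>The choice of \<open>t\<close> makes \<open>t / l\<close> times
    \<open>lambda_min2 S\<close> equal to \<open>mu / (l - 1)\<close>. This dominates
    \<open>mu / l\<close>, which gives the positivity of \<open>G i\<close> below.\<close>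
  have tz: "t / l * zeta = 1 / (real l - 1)" unfolding t_def using zpos l1 by (simp add: field_simps)
  have hS: "h \<bullet> (S *\<^sub>v h) = lambda_min S * (h \<bullet> h)" using hmin h by simp
  define H where "H i = ((1 - t) \<cdot>\<^sub>m Q i + (t / l) \<cdot>\<^sub>m S) - (mu / l) \<cdot>\<^sub>m 1\<^sub>m 4" for i
  define G where "G i = orth_compress 4 h (H i)" for i
  have H: "H i \<in> carrier_mat 4 4" "(H i)\<^sup>T = H i" if i: "i \<in> {1..l}" for i
  proof -
    have c: "(1 - t) \<cdot>\<^sub>m Q i \<in> carrier_mat 4 4" "(t / l) \<cdot>\<^sub>m S \<in> carrier_mat 4 4" "(mu / l) \<cdot>\<^sub>m 1\<^sub>m 4 \<in> carrier_mat 4 4"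
      using Q(1)[OF i] S by simp_all
    then show "H i \<in> carrier_mat 4 4" unfolding H_def by (intro minus_carrier_mat)
    have e: "A $$ (s,r) = A $$ (r,s)" if "A \<in> carrier_mat 4 4" "A\<^sup>T = A" "r < 4" "s < 4" for A :: "real mat" and r s
      using that by (metis carrier_matD index_transpose_mat(1))
    show "(H i)\<^sup>T = H i"
      unfolding H_def using Q(1)[OF i] S e[OF Q(1)[OF i] Q(2)[OF i]] e[OF S] by (intro eq_matI) auto
  qed
  have Hform: "u \<bullet> (H i *\<^sub>v u) = (1 - t) * (u \<bullet> (Q i *\<^sub>v u)) + t / l * (u \<bullet> (S *\<^sub>v u)) - mu / l * (u \<bullet> u)"
    if i: "i \<in> {1..l}" and u: "u \<in> carrier_vec 4" for i u
  proof -
    have "(1 - t) \<cdot>\<^sub>m Q i \<in> carrier_mat 4 4" "(t / l) \<cdot>\<^sub>m S \<in> carrier_mat 4 4" "(mu / l) \<cdot>\<^sub>m 1\<^sub>m 4 \<in> carrier_mat 4 4"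
      using Q(1)[OF i] S by simp_all
    then show ?thesis
      unfolding H_def using u form_minus[of _ 4 "(mu / l) \<cdot>\<^sub>m 1\<^sub>m 4" u u] form_add[of _ 4 "(t / l) \<cdot>\<^sub>m S" u u]
        form_smult[OF Q(1)[OF i] u u] form_smult[OF S(1) u u] form_smult_one[OF u u]
      by simp
  qed
  have G: "G i \<in> carrier_mat 4 4" "(G i)\<^sup>T = G i"
    "v \<in> carrier_vec 4 \<Longrightarrow> v \<bullet> (G i *\<^sub>v v) = (v - (h \<bullet> v) \<cdot>\<^sub>v h) \<bullet> (H i *\<^sub>v (v - (h \<bullet> v) \<cdot>\<^sub>v h))"
    if "i \<in> {1..l}" for i v
    unfolding G_def using orth_compress[OF H[OF that] h(1)] by auto
  let ?u = "\<lambda>v. v - (h \<bullet> v) \<cdot>\<^sub>v h"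
  note split = orthogonal_split[OF h]
  have S_u: "lambda_min2 S * (?u v \<bullet> ?u v) \<le> ?u v \<bullet> (S *\<^sub>v ?u v)" if v: "v \<in> carrier_vec 4" for v
    using lambda_min_vector(2)[OF S h(1) hS split(1)[OF v] h(2) split(2)[OF v]] by simp
  have sq_nonneg: "v \<bullet> v \<ge> 0" for v :: "real vec" by (simp add: scalar_prod_def sum_nonneg)
  show ?thesis
  proof (rule sdr_tight_atI)
    show "qcqp_feasible l (stack l h)" using stack_feasible h by blast
    fix W assume W: "sdr_feasible l W"
    have le: "1 \<le> l" using l by simp
    have obj: "relax_obj l Q c2 (outer (stack l h)) = mu"
      unfolding mu_eq by (rule relax_obj_stack[OF Q h])
    show "relax_obj l Q c2 (outer (stack l h)) \<le> relax_obj l Q c2 W"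
      unfolding obj
    proof (rule sdr_lower_bound[OF Q G(1,2) _ _ _ le W])
      fix i and v :: "real vec" assume i: "i \<in> {1..l}" and v: "v \<in> carrier_vec 4"
      let ?w = "?u v" and ?q = "h \<bullet> (Q i *\<^sub>v h)" and ?N = "vnorm (Q i *\<^sub>v h)"
      have w: "?w \<in> carrier_vec 4" by (rule split(1)[OF v])
      have Gv: "v \<bullet> (G i *\<^sub>v v) = (1 - t) * (?w \<bullet> (Q i *\<^sub>v ?w)) + t / l * (?w \<bullet> (S *\<^sub>v ?w)) - mu / l * (?w \<bullet> ?w)"
        unfolding G(3)[OF i v] by (rule Hform[OF i w])
      have "mu / l * (?w \<bullet> ?w) \<le> mu / (real l - 1) * (?w \<bullet> ?w)"
        using mupos l1 sq_nonneg by (intro mult_right_mono divide_left_mono) auto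
      also have "\<dots> = 1 / (real l - 1) * (mu * (?w \<bullet> ?w))" by simp
      also have "\<dots> = t / l * (lambda_min2 S * (?w \<bullet> ?w))"
        unfolding lam2 tz[symmetric] by simp
      also have "\<dots> \<le> t / l * (?w \<bullet> (S *\<^sub>v ?w))"
        using S_u[OF v] tpos l1 by (intro mult_left_mono) auto
      finally show "v \<bullet> (G i *\<^sub>v v) \<ge> 0"
        unfolding Gv using Qpos[OF i w] t1 by (simp add: add_increasing)
      let ?M = "msum4 ({1..l} - {i}) (\<lambda>j. Q i - Q j)"
      have M: "?M \<in> carrier_mat 4 4" by simp
      have symM: "?M\<^sup>T = ?M"
        by (rule msum4_symmetric) (use Q i in \<open>auto intro: minus_carrier_mat symmetric_minus[of _ 4]\<close>)
      have "?w \<bullet> (?M *\<^sub>v ?w) = (\<Sum>j\<in>{1..l} - {i}. ?w \<bullet> ((Q i - Q j) *\<^sub>v ?w))"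
        by (rule msum4_form) (use Q i w in \<open>auto intro: minus_carrier_mat\<close>)
      also have "\<dots> = (\<Sum>j\<in>{1..l} - {i}. ?w \<bullet> (Q i *\<^sub>v ?w) - ?w \<bullet> (Q j *\<^sub>v ?w))"
        by (intro sum.cong refl form_minus[OF Q(1)[OF i] Q(1) w w]) auto
      \<comment> \<open>The index \<open>j = i\<close> contributes zero, so it may be added back to
        obtain \<open>l\<close> copies of \<open>Q i\<close> minus \<open>S\<close>.\<close>
      also have "\<dots> = (\<Sum>j\<in>{1..l}. ?w \<bullet> (Q i *\<^sub>v ?w) - ?w \<bullet> (Q j *\<^sub>v ?w))"
        using i sum.remove[of "{1..l}" i "\<lambda>j. ?w \<bullet> (Q i *\<^sub>v ?w) - ?w \<bullet> (Q j *\<^sub>v ?w)"] by simp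
      also have "\<dots> = l * (?w \<bullet> (Q i *\<^sub>v ?w)) - ?w \<bullet> (S *\<^sub>v ?w)"
        by (simp add: sum_subtractf Sform[OF w w])
      finally have Mw: "l * (?w \<bullet> (Q i *\<^sub>v ?w)) - ?w \<bullet> (S *\<^sub>v ?w) \<le> lambda_max ?M * (?w \<bullet> ?w)"
        using le_lambda_max[OF M symM w] by simp
      \<comment> \<open>Since \<open>t / l\<close> equals \<open>1 / (zeta * (l - 1))\<close>, the
        bound by \<open>lambda_max\<close> becomes the last summand of \<open>d i\<close>. Adding
        \<open>mu / l\<close>, the first summand, leaves the coefficient
        \<open>?q + d i\<close>.\<close>
      have "t * (?w \<bullet> (Q i *\<^sub>v ?w)) - t / l * (?w \<bullet> (S *\<^sub>v ?w)) = t / l * (l * (?w \<bullet> (Q i *\<^sub>v ?w)) - ?w \<bullet> (S *\<^sub>v ?w))"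
        using l1 by (simp add: field_simps)
      also have "\<dots> \<le> t / l * (lambda_max ?M * (?w \<bullet> ?w))"
        using Mw tpos l1 by (intro mult_left_mono) auto
      also have "\<dots> = lambda_max ?M / (zeta * (real l - 1)) * (?w \<bullet> ?w)"
        using l1 by (simp add: t_def)
      finally have tail: "t * (?w \<bullet> (Q i *\<^sub>v ?w)) - t / l * (?w \<bullet> (S *\<^sub>v ?w)) + mu / l * (?w \<bullet> ?w) \<le> (?q + d i) * (?w \<bullet> ?w)"
        unfolding d_def mu_eq[symmetric] by (simp add: algebra_simps)
      have Qh: "Q i *\<^sub>v h \<in> carrier_vec 4" using Q(1)[OF i] h by simp
      \<comment> \<open>The mixed term costs \<open>?N\<close> times the full squared length:
        Cauchy-Schwarz, then 2ab \<le> a^2 + b^2 with a and b the lengths of the two components of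
        \<open>v\<close>.\<close>
      have "2 * (h \<bullet> v) * (h \<bullet> (Q i *\<^sub>v ?w)) = 2 * (h \<bullet> v) * (?w \<bullet> (Q i *\<^sub>v h))"
        using symmetric_form_commute[OF Q(1)[OF i] Q(2)[OF i] h(1) w] by simp
      also have "\<dots> \<le> 2 * \<bar>h \<bullet> v\<bar> * \<bar>?w \<bullet> (Q i *\<^sub>v h)\<bar>"
        by (simp add: abs_mult[symmetric])
      also have "\<dots> \<le> 2 * \<bar>h \<bullet> v\<bar> * (vnorm ?w * ?N)"
        by (intro mult_left_mono scalar_prod_Cauchy_Schwarz[OF w Qh]) auto
      also have "\<dots> = ?N * (2 * \<bar>h \<bullet> v\<bar> * vnorm ?w)" by simp
      also have "\<dots> \<le> ?N * (\<bar>h \<bullet> v\<bar>\<^sup>2 + (vnorm ?w)\<^sup>2)"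
        by (intro mult_left_mono sum_squares_bound) auto
      also have "\<dots> = ?N * (v \<bullet> v)" using split(4)[OF v] by (simp add: sq_vnorm)
      finally have cross: "2 * (h \<bullet> v) * (h \<bullet> (Q i *\<^sub>v ?w)) \<le> ?N * (v \<bullet> v)" .
      let ?p = "(\<bar>d i\<bar> + d i) / 2"
      have Qv: "v \<bullet> (Q i *\<^sub>v v) = (h \<bullet> v)\<^sup>2 * ?q + 2 * (h \<bullet> v) * (h \<bullet> (Q i *\<^sub>v ?w)) + ?w \<bullet> (Q i *\<^sub>v ?w)"
        using form_expand[OF Q(1)[OF i] Q(2)[OF i] h(1) w, of "h \<bullet> v"] split(3)[OF v] by simp
      have "v \<bullet> (Q i *\<^sub>v v) - v \<bullet> (G i *\<^sub>v v) = (h \<bullet> v)\<^sup>2 * ?q + 2 * (h \<bullet> v) * (h \<bullet> (Q i *\<^sub>v ?w))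
          + (t * (?w \<bullet> (Q i *\<^sub>v ?w)) - t / l * (?w \<bullet> (S *\<^sub>v ?w)) + mu / l * (?w \<bullet> ?w))"
        unfolding Gv Qv by (simp add: algebra_simps)
      \<comment> \<open>The positive part \<open>?p\<close> of \<open>d i\<close> serves both
        directions: it bounds \<open>d i\<close> on the complement and is nonnegative along
        \<open>h\<close>, so one coefficient multiplies the whole squared length.\<close>
      also have "\<dots> \<le> (h \<bullet> v)\<^sup>2 * (?q + ?p) + ?N * (v \<bullet> v) + (?q + ?p) * (?w \<bullet> ?w)"
        using cross tail sq_nonneg by (intro add_mono order_trans[OF tail] mult_left_mono mult_right_mono) auto
      also have "\<dots> = (?q + ?N + ?p) * (v \<bullet> v)"
        unfolding split(4)[OF v] by (simp add: algebra_simps)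
      also have "\<dots> \<le> c2 i * (v \<bullet> v)"
        using c[OF i] sq_nonneg by (intro mult_right_mono) auto
      finally show "v \<bullet> (Q i *\<^sub>v v) - v \<bullet> (G i *\<^sub>v v) \<le> c2 i * (v \<bullet> v)" .
    next
      fix v :: "real vec" assume v: "v \<in> carrier_vec 4"
      let ?w = "?u v"
      have w: "?w \<in> carrier_vec 4" by (rule split(1)[OF v])
      \<comment> \<open>Summed over \<open>i\<close>, the weights \<open>1 - t\<close> and
        \<open>t\<close> recombine to the full form of \<open>S\<close>, so the \<open>G i\<close>
        add up to the compression of \<open>S\<close> minus \<open>mu\<close> times the
        identity.\<close>
      have "(\<Sum>i=1..l. v \<bullet> (G i *\<^sub>v v)) = (\<Sum>i=1..l. (1 - t) * (?w \<bullet> (Q i *\<^sub>v ?w)) + t / l * (?w \<bullet> (S *\<^sub>v ?w)) - mu / l * (?w \<bullet> ?w))"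
        by (intro sum.cong refl) (simp add: G(3)[OF _ v] Hform[OF _ w])
      also have "\<dots> = (1 - t) * (\<Sum>i=1..l. ?w \<bullet> (Q i *\<^sub>v ?w)) + t * (?w \<bullet> (S *\<^sub>v ?w)) - mu * (?w \<bullet> ?w)"
        using l1 by (simp add: sum.distrib sum_subtractf sum_distrib_left)
      also have "\<dots> = ?w \<bullet> (S *\<^sub>v ?w) - mu * (?w \<bullet> ?w)"
        unfolding Sform[OF w w, symmetric] by (simp add: algebra_simps)
      finally have Gs: "(\<Sum>i=1..l. v \<bullet> (G i *\<^sub>v v)) = ?w \<bullet> (S *\<^sub>v ?w) - mu * (?w \<bullet> ?w)" .
      \<comment> \<open>The eigenvector property removes the mixed term, so the form of
        \<open>S\<close> is \<open>mu\<close> along \<open>h\<close> plus its compression, and the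
        required bound holds with equality.\<close>
      have "h \<bullet> (S *\<^sub>v ?w) = 0"
        using lambda_min_vector(1)[OF S h(1) hS w] split(2)[OF v] by simp
      then have "v \<bullet> (S *\<^sub>v v) = (h \<bullet> v)\<^sup>2 * mu + ?w \<bullet> (S *\<^sub>v ?w)"
        using form_expand[OF S h(1) w, of "h \<bullet> v"] split(3)[OF v] hmin by (simp add: mu_def)
      then show "mu * (v \<bullet> v) \<le> (\<Sum>i=1..l. v \<bullet> (Q i *\<^sub>v v) - v \<bullet> (G i *\<^sub>v v))"
        unfolding sum_subtractf Gs Sform[OF v v, symmetric] split(4)[OF v] by (simp add: algebra_simps)
    qed
  qed
qed

text \<open>Otherwise \<open>T\<close> has two orthonormal zeros, which are zeros of every summand.
  The resulting right multiplication \<open>J\<close> preserves the form of \<open>S\<close>, so a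
  minimising unit vector and its orthogonal image under \<open>J\<close> attain the same value,
  contradicting the gap.\<close>

lemma lambda_min2_data_pos:
  assumes S_def: "S = msum4 {1..l} (\<lambda>i. quat_form (y i) (x i))" and T_def: "T = msum4 {1..l} (\<lambda>i. quat_form (z i) (x i))"
    and gap: "lambda_min S < lambda_min2 S"
  shows "lambda_min2 T > 0"
proof (rule ccontr)
  assume "\<not> lambda_min2 T > 0"
  have S: "S \<in> carrier_mat 4 4" "S\<^sup>T = S" and T: "T \<in> carrier_mat 4 4" "T\<^sup>T = T"
    unfolding S_def T_def by (simp_all add: msum4_symmetric quat_form_symmetric)
  have form: "u \<bullet> (msum4 {1..l} (\<lambda>i. quat_form (a i) (x i)) *\<^sub>v u) = (\<Sum>i=1..l. u \<bullet> (quat_form (a i) (x i) *\<^sub>v u))"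
    if "u \<in> carrier_vec 4" for u a by (rule msum4_form) (use that in auto)
  have nonneg: "u \<bullet> (quat_form a b *\<^sub>v u) \<ge> 0" if "u \<in> carrier_vec 4" for u a b
    unfolding quat_form_form[OF that] by (simp add: scalar_prod_def sum_nonneg)
  obtain u v where uv: "u \<in> carrier_vec 4" "v \<in> carrier_vec 4" "u \<bullet> u = 1" "v \<bullet> v = 1" "u \<bullet> v = 0"
    and "u \<bullet> (T *\<^sub>v u) \<le> lambda_min2 T" "v \<bullet> (T *\<^sub>v v) \<le> lambda_min2 T"
    by (rule lambda_min2_subspace[OF T]) auto
  then have "u \<bullet> (T *\<^sub>v u) \<le> 0" "v \<bullet> (T *\<^sub>v v) \<le> 0" using \<open>\<not> lambda_min2 T > 0\<close> by auto
  moreover have "w \<bullet> (quat_form (z i) (x i) *\<^sub>v w) = 0"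
    if w: "w \<in> carrier_vec 4" "w \<bullet> (T *\<^sub>v w) \<le> 0" and i: "i \<in> {1..l}" for w i
  proof -
    have "(\<Sum>i=1..l. w \<bullet> (quat_form (z i) (x i) *\<^sub>v w)) = 0"
      using w(2) nonneg[OF w(1)] unfolding T_def form[OF w(1)] by (intro antisym sum_nonneg) auto
    then show ?thesis using i nonneg[OF w(1)] by (subst (asm) sum_nonneg_eq_0_iff) auto
  qed
  ultimately have z0: "u \<bullet> (quat_form (z i) (x i) *\<^sub>v u) = 0" "v \<bullet> (quat_form (z i) (x i) *\<^sub>v v) = 0"
    if "i \<in> {1..l}" for i using that uv by auto
  obtain J where J: "\<And>w. w \<in> carrier_vec 4 \<Longrightarrow> J w \<in> carrier_vec 4"
    "\<And>w. w \<in> carrier_vec 4 \<Longrightarrow> w \<bullet> w = 1 \<Longrightarrow> J w \<bullet> J w = 1 \<and> w \<bullet> J w = 0"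
    "\<And>z y x w. w \<in> carrier_vec 4 \<Longrightarrow> u \<bullet> (quat_form z x *\<^sub>v u) = 0 \<Longrightarrow> v \<bullet> (quat_form z x *\<^sub>v v) = 0 \<Longrightarrow>
      J w \<bullet> (quat_form y x *\<^sub>v J w) = w \<bullet> (quat_form y x *\<^sub>v w)"
    by (rule quat_form_mult_right[OF uv(1,3,2,4,5)]) blast
  obtain h where h: "h \<in> carrier_vec 4" "h \<bullet> h = 1" "h \<bullet> (S *\<^sub>v h) = lambda_min S"
    by (rule lambda_min_attained[OF S]) auto
  \<comment> \<open>The zeros concern the targets \<open>z i\<close>, but \<open>J\<close> preserves
    the forms built from \<open>y i\<close> as well, because both share the same
    \<open>x i\<close>.\<close>
  have "J h \<bullet> (S *\<^sub>v J h) = h \<bullet> (S *\<^sub>v h)"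
    unfolding S_def form[OF h(1)] form[OF J(1)[OF h(1)]] by (intro sum.cong refl J(3)[OF h(1) z0(1) z0(2)])
  moreover have "lambda_min2 S * (J h \<bullet> J h) \<le> J h \<bullet> (S *\<^sub>v J h)"
    using lambda_min_vector(2)[OF S h(1) _ J(1)[OF h(1)] h(2)] h J(2)[OF h(1,2)] by simp
  ultimately show False using gap h J(2)[OF h(1,2)] by simp
qed

text \<open>Expanding the squared residual at \<open>h\<close> around the noiseless target leaves
  the cross terms \<open>2 * (e \<bullet> ?a) - 2 * (e \<bullet> ?b)\<close>, where
  \<open>?a\<close> and \<open>?b\<close> are rotated copies of \<open>x\<close>; each is at most
  twice the product of the lengths of \<open>e\<close> and \<open>x\<close>. The square of
  \<open>e\<close> cancels against the residual at \<open>w0\<close>, which is exactly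
  \<open>e\<close>.\<close>

lemma quat_data_form_bound:
  assumes h: "h \<in> sphere3" and w0: "w0 \<in> sphere3"
    and x: "x \<in> carrier_vec 3" and e: "e \<in> carrier_vec 3"
  shows "h \<bullet> (quat_form (rotq w0 *\<^sub>v x) x *\<^sub>v h)
      \<le> h \<bullet> (quat_form (rotq w0 *\<^sub>v x + e) x *\<^sub>v h) - w0 \<bullet> (quat_form (rotq w0 *\<^sub>v x + e) x *\<^sub>v w0)
        + 4 * (vnorm e * vnorm x)"
proof -
  let ?a = "rotq w0 *\<^sub>v x" and ?b = "rotq h *\<^sub>v x"
  have a: "?a \<in> carrier_vec 3" and b: "?b \<in> carrier_vec 3"
    using mult_mat_vec_carrier[OF rotq_carrier x] by auto
  have f: "w \<bullet> (quat_form y x *\<^sub>v w) = (vnorm (y - rotq w *\<^sub>v x))\<^sup>2"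
    if "w \<in> sphere3" "y \<in> carrier_vec 3" for w y
    using that rotq_residual[OF that x] by (simp add: quat_form_form sphere3_iff)
  have ea: "\<bar>e \<bullet> ?a\<bar> \<le> vnorm e * vnorm x" and eb: "\<bar>e \<bullet> ?b\<bar> \<le> vnorm e * vnorm x"
    using scalar_prod_Cauchy_Schwarz[OF e a] scalar_prod_Cauchy_Schwarz[OF e b] rotq_norm[OF w0 x] rotq_norm[OF h x] by auto
  have sq: "(a + e - b) \<bullet> (a + e - b) = (a - b) \<bullet> (a - b) + 2 * (e \<bullet> a) - 2 * (e \<bullet> b) + e \<bullet> e"
    if "a \<in> carrier_vec 3" "b \<in> carrier_vec 3" "e \<in> carrier_vec 3" for a b e :: "real vec"
    using that by (simp add: scalar_prod_3 algebra_simps)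
  have exp_h: "(vnorm (?a + e - ?b))\<^sup>2 = (vnorm (?a - ?b))\<^sup>2 + 2 * (e \<bullet> ?a) - 2 * (e \<bullet> ?b) + e \<bullet> e"
    unfolding sq_vnorm by (rule sq[OF a b e])
  have exp_0: "(vnorm (?a + e - ?a))\<^sup>2 = e \<bullet> e"
    unfolding sq_vnorm using sq[OF a a e] a by simp
  show ?thesis
    unfolding f[OF h a] f[OF h add_carrier_vec[OF a e]] f[OF w0 add_carrier_vec[OF a e]] exp_h exp_0
    using ea eb by (simp add: abs_le_iff)
qed

theorem theorem3p7:
  fixes l :: nat
    and w0 :: "real vec"              \<comment> \<open>unit quaternion w_0^* of R_0^*\<close>
    and x eps :: "nat \<Rightarrow> real vec"    \<comment> \<open>x_i, \<epsilon>_i in R^3\<close>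
    and c2 :: "nat \<Rightarrow> real"           \<comment> \<open>c_i^2\<close>
    and w0h :: "real vec"             \<comment> \<open>\<hat>w_0\<close>
  defines "R0 \<equiv> rotq w0"
  defines "y \<equiv> (\<lambda>i. R0 *\<^sub>v x i + eps i)"
  defines "Q \<equiv> (\<lambda>i. Qmat (y i) (x i))"
  defines "P \<equiv> (\<lambda>i. Pmat R0 (x i))"
  defines "zeta \<equiv> lambda_min2 (msum4 {1..l} Q) / lambda_min (msum4 {1..l} Q)"
  defines "d \<equiv> (\<lambda>i. (\<Sum>k=1..l. w0h \<bullet> (Q k *\<^sub>v w0h)) / real l - w0h \<bullet> (Q i *\<^sub>v w0h)
                 + lambda_max (msum4 ({1..l} - {i}) (\<lambda>j. Q i - Q j)) / (zeta * (real l - 1)))"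
  assumes "l \<ge> 2"
    and "w0 \<in> sphere3"
    and "\<forall>i\<in>{1..l}. dim_vec (x i) = 3 \<and> dim_vec (eps i) = 3"
    and "\<forall>i\<in>{1..l}. c2 i \<ge> 0"
    and "w0h \<in> sphere3"
    and "\<forall>w\<in>sphere3. tlsq_obj l Q c2 w0h \<le> tlsq_obj l Q c2 w"
    and "zeta \<ge> real l / (real l - 1)"
    and "\<forall>i\<in>{1..l}. c2 i > w0h \<bullet> (Q i *\<^sub>v w0h) + vnorm (Q i *\<^sub>v w0h) + (\<bar>d i\<bar> + d i) / 2"
  shows "sdr_tight_at l Q c2 (stack l w0h)
         \<and> 1 - (w0h \<bullet> w0)^2 \<le> 4 * (\<Sum>i=1..l. vnorm (eps i) * vnorm (x i)) / lambda_min2 (msum4 {1..l} P)"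
proof -
  note l = assms(7) and w0 = assms(8) and opt = assms(12) and zeta = assms(13) and c = assms(14)
  let ?I = "{1..l}"
  let ?S = "msum4 ?I Q" and ?T = "msum4 ?I P"
  have h: "w0h \<in> carrier_vec 4" "w0h \<bullet> w0h = 1" and h3: "w0h \<in> sphere3"
    using \<open>w0h \<in> sphere3\<close> by (auto simp: sphere3_iff)
  have v0: "w0 \<in> carrier_vec 4" "w0 \<bullet> w0 = 1" using w0 by (auto simp: sphere3_iff)
  have x: "x i \<in> carrier_vec 3" and e: "eps i \<in> carrier_vec 3" if "i \<in> ?I" for i
    using that assms(9) by (auto intro: carrier_vecI)
  have Rx: "R0 *\<^sub>v x i \<in> carrier_vec 3" if "i \<in> ?I" for i
    unfolding R0_def by (rule mult_mat_vec_carrier[OF rotq_carrier x[OF that]])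
  have Qeq: "Q i = quat_form (R0 *\<^sub>v x i + eps i) (x i)" if "i \<in> ?I" for i
    unfolding Q_def y_def using that Rx x e by (intro Qmat_eq_quat_form) auto
  have Peq: "P i = quat_form (R0 *\<^sub>v x i) (x i)" if "i \<in> ?I" for i
    using Qmat_eq_quat_form[OF Rx[OF that] x[OF that]] by (simp add: P_def Pmat_def Qmat_def)
  have sums: "?S = msum4 ?I (\<lambda>i. quat_form (R0 *\<^sub>v x i + eps i) (x i))"
    "?T = msum4 ?I (\<lambda>i. quat_form (R0 *\<^sub>v x i) (x i))"
    unfolding msum4_def by (intro eq_matI; simp add: Qeq Peq)+
  have Q: "Q i \<in> carrier_mat 4 4" "(Q i)\<^sup>T = Q i" and P: "P i \<in> carrier_mat 4 4" "(P i)\<^sup>T = P i" if "i \<in> ?I" for i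
    using that by (simp_all add: Qeq Peq quat_form_symmetric)
  have Qpos: "v \<bullet> (Q i *\<^sub>v v) \<ge> 0" and Ppos: "v \<bullet> (P i *\<^sub>v v) \<ge> 0"
    if "i \<in> ?I" "v \<in> carrier_vec 4" for i v
    unfolding Qeq[OF that(1)] Peq[OF that(1)] quat_form_form[OF that(2)] by (simp_all add: scalar_prod_def sum_nonneg)
  have S: "?S \<in> carrier_mat 4 4" "?S\<^sup>T = ?S" and T: "?T \<in> carrier_mat 4 4" "?T\<^sup>T = ?T"
    using msum4_symmetric[of ?I Q] msum4_symmetric[of ?I P] Q P by auto
  have Sform: "v \<bullet> (?S *\<^sub>v v) = (\<Sum>i=1..l. v \<bullet> (Q i *\<^sub>v v))" if "v \<in> carrier_vec 4" for v
    by (rule msum4_form) (use Q that in auto)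
  have Tform: "v \<bullet> (?T *\<^sub>v v) = (\<Sum>i=1..l. v \<bullet> (P i *\<^sub>v v))" if "v \<in> carrier_vec 4" for v
    by (rule msum4_form) (use P that in auto)
  \<comment> \<open>The bounds on \<open>c2\<close> make every truncation inactive at
    \<open>w0h\<close>, and elsewhere truncation only lowers the objective. Hence \<open>w0h\<close>
    also minimises the untruncated form.\<close>
  have min: "w0h \<bullet> (?S *\<^sub>v w0h) \<le> w \<bullet> (?S *\<^sub>v w)" if "w \<in> sphere3" for w
  proof -
    have le: "a \<le> b" if "a + n + (\<bar>r\<bar> + r) / 2 < b" "0 \<le> n" for a b n r :: real
      using that by (simp add: abs_if split: if_splits)
    have "w0h \<bullet> (Q i *\<^sub>v w0h) \<le> c2 i" if "i \<in> ?I" for i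
      by (rule le[OF c[rule_format, OF that] vnorm_nonneg])
    then have "w0h \<bullet> (?S *\<^sub>v w0h) = tlsq_obj l Q c2 w0h"
      unfolding Sform[OF h(1)] tlsq_obj_def by (intro sum.cong refl) (simp add: min_def)
    also have "\<dots> \<le> tlsq_obj l Q c2 w" using opt that by blast
    also have "\<dots> \<le> w \<bullet> (?S *\<^sub>v w)"
      using that unfolding tlsq_obj_def by (subst Sform) (auto simp: sphere3_iff intro!: sum_mono)
    finally show ?thesis .
  qed
  have hmin: "w0h \<bullet> (?S *\<^sub>v w0h) = lambda_min ?S"
  proof (rule antisym)
    show "lambda_min ?S \<le> w0h \<bullet> (?S *\<^sub>v w0h)" using lambda_min_le[OF S h(1)] h by simp
    obtain v where "v \<in> carrier_vec 4" "v \<bullet> v = 1" "v \<bullet> (?S *\<^sub>v v) = lambda_min ?S"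
      by (rule lambda_min_attained[OF S]) auto
    then show "w0h \<bullet> (?S *\<^sub>v w0h) \<le> lambda_min ?S" using min[of v] by (simp add: sphere3_iff)
  qed
  have tight: "sdr_tight_at l Q c2 (stack l w0h)"
    by (rule sdr_tight_at_stack[OF l Q Qpos h hmin])
      (use zeta c in \<open>auto simp: zeta_def d_def\<close>)
  have "lambda_min ?S \<ge> 0"
    unfolding hmin[symmetric] Sform[OF h(1)] using Qpos h by (intro sum_nonneg) auto
  moreover have "zeta > 1"
    using less_le_trans[OF _ zeta, of 1] l by simp
  \<comment> \<open>A zero \<open>lambda_min ?S\<close> would make the quotient \<open>zeta\<close>
    zero by the convention for division, so \<open>zeta > 1\<close> can be read as a strict
    gap.\<close>
  ultimately have gap: "lambda_min ?S < lambda_min2 ?S"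
    unfolding zeta_def by (cases "lambda_min ?S = 0") (auto simp: less_divide_eq)
  have T2: "lambda_min2 ?T > 0" by (rule lambda_min2_data_pos[OF sums gap])
  have w0T: "w0 \<bullet> (?T *\<^sub>v w0) = 0"
    unfolding Tform[OF v0(1)]
  proof (intro sum.neutral ballI)
    fix i assume i: "i \<in> ?I"
    have "w0 \<bullet> (P i *\<^sub>v w0) = (vnorm (R0 *\<^sub>v x i - rotq w0 *\<^sub>v x i))\<^sup>2"
      unfolding Peq[OF i] quat_form_form[OF v0(1)] rotq_residual[OF w0 Rx[OF i] x[OF i]] ..
    also have "\<dots> = 0"
      using Rx[OF i] unfolding R0_def sq_vnorm by simp
    finally show "w0 \<bullet> (P i *\<^sub>v w0) = 0" .
  qed
  have "lambda_min ?T \<ge> 0"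
  proof -
    obtain v where "v \<in> carrier_vec 4" "v \<bullet> (?T *\<^sub>v v) = lambda_min ?T"
      by (rule lambda_min_attained[OF T]) auto
    then show ?thesis using Tform Ppos by (metis sum_nonneg)
  qed
  moreover have "lambda_min ?T \<le> 0" using lambda_min_le[OF T v0(1)] v0 w0T by simp
  \<comment> \<open>\<open>w0\<close> is a null vector of the semidefinite \<open>?T\<close>, hence
    a minimiser of its form, and \<open>lambda_min2 ?T\<close> governs the complement of
    \<open>w0\<close>.\<close>
  ultimately have T0: "lambda_min ?T = 0" by simp
  let ?u = "w0h - (w0 \<bullet> w0h) \<cdot>\<^sub>v w0"
  note u = orthogonal_split[OF v0 h(1)]
  have w0T': "w0 \<bullet> (?T *\<^sub>v w0) = lambda_min ?T * (w0 \<bullet> w0)" using w0T T0 by simp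
  have "w0 \<bullet> (?T *\<^sub>v ?u) = 0" using lambda_min_vector(1)[OF T v0(1) w0T' u(1)] T0 by simp
  then have hT: "w0h \<bullet> (?T *\<^sub>v w0h) = ?u \<bullet> (?T *\<^sub>v ?u)"
    using form_expand[OF T v0(1) u(1), of "w0 \<bullet> w0h"] w0T u(3) by simp
  \<comment> \<open>The squared length of the component of \<open>w0h\<close> orthogonal to
    \<open>w0\<close> is the squared sine of the angle.\<close>
  have "lambda_min2 ?T * (1 - (w0h \<bullet> w0)\<^sup>2) = lambda_min2 ?T * (?u \<bullet> ?u)"
    using u(4) h comm_scalar_prod[OF h(1) v0(1)] by simp
  also have "\<dots> \<le> w0h \<bullet> (?T *\<^sub>v w0h)"
    unfolding hT using lambda_min_vector(2)[OF T v0(1) w0T' u(1) v0(2) u(2)] by simp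
  also have "\<dots> \<le> (\<Sum>i=1..l. w0h \<bullet> (Q i *\<^sub>v w0h) - w0 \<bullet> (Q i *\<^sub>v w0) + 4 * (vnorm (eps i) * vnorm (x i)))"
    unfolding Tform[OF h(1)]
  proof (rule sum_mono)
    fix i assume i: "i \<in> ?I"
    show "w0h \<bullet> (P i *\<^sub>v w0h) \<le> w0h \<bullet> (Q i *\<^sub>v w0h) - w0 \<bullet> (Q i *\<^sub>v w0) + 4 * (vnorm (eps i) * vnorm (x i))"
      unfolding Peq[OF i] Qeq[OF i] R0_def by (rule quat_data_form_bound[OF h3 w0 x[OF i] e[OF i]])
  qed
  also have "\<dots> = w0h \<bullet> (?S *\<^sub>v w0h) - w0 \<bullet> (?S *\<^sub>v w0) + 4 * (\<Sum>i=1..l. vnorm (eps i) * vnorm (x i))"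
    unfolding Sform[OF h(1)] Sform[OF v0(1)] by (simp add: sum.distrib sum_subtractf sum_distrib_left)
  \<comment> \<open>Comparing \<open>w0h\<close> with the true \<open>w0\<close> in the minimality
    makes the difference of the two forms nonpositive.\<close>
  also have "\<dots> \<le> 4 * (\<Sum>i=1..l. vnorm (eps i) * vnorm (x i))" using min[OF w0] by simp
  finally have "1 - (w0h \<bullet> w0)\<^sup>2 \<le> 4 * (\<Sum>i=1..l. vnorm (eps i) * vnorm (x i)) / lambda_min2 ?T"
    using T2 by (simp add: pos_le_divide_eq mult.commute)
  with tight show ?thesis by blast
qed

end
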